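(* Let $\alpha,\beta>-1$ and $\gamma_n=n+\frac{\alpha+\beta+1}{2}$. The inequality \[ \gamma_n\theta_{n,k}^{(\alpha,\beta)}\leq\gamma_{n+1}\theta_{n+1,k}^{(\alpha,\beta)} \] holds for every integer $n\geq1$ and every $1\leq k\leq n$ if and only if $(\alpha,\beta)\in\mathcal D_\uparrow$. Likewise, \[ \gamma_{n+1}\theta_{n+1,k}^{(\alpha,\beta)}\leq\gamma_n\theta_{n,k}^{(\alpha,\beta)} \] holds for every integer $n\geq1$ and every $1\leq k\leq n$ if and only if $(\alpha,\beta)\in\mathcal D_\downarrow$.
   Context: $P_n^{(\alpha,\beta)}$ denotes the Jacobi polynomial of degree $n$ (orthogonal on $(-1,1)$ with respect to the weight $(1-x)^\alpha(1+x)^\beta$). For $\alpha,\beta>-1$ its $n$ zeros are simple and lie in $(-1,1)$; they are written $\cos\theta_{n,k}^{(\alpha,\beta)}$, $1\le k\le n$, with $0<\theta_{n,1}^{(\alpha,\beta)}<\cdots<\theta_{n,n}^{(\alpha,\beta)}<\pi$. The parameter regions are \[ \mathcal D_\downarrow=\{(\alpha,\beta)\in(-1,\infty)^2:\ |\beta|\geq\tfrac12,\ \alpha^2+3\beta^2\geq1\}, \] \[ \mathcal D_\uparrow=\{(\alpha,\beta)\in(-1,\infty)^2:\ |\beta|\leq\tfrac12,\ \alpha^2+3\beta^2\leq1\}. \] *)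

theory Defs
  imports "HOL-Analysis.Analysis" "HOL-Computational_Algebra.Polynomial"
begin

definition jacobi_weight :: "real \<Rightarrow> real \<Rightarrow> real \<Rightarrow> real" where
  "jacobi_weight \<alpha> \<beta> x = (1 - x) powr \<alpha> * (1 + x) powr \<beta>"

definition jacobi_inner :: "real \<Rightarrow> real \<Rightarrow> real poly \<Rightarrow> real poly \<Rightarrow> real" where
  "jacobi_inner \<alpha> \<beta> p q =
     set_lebesgue_integral lborel {-1<..<1} (\<lambda>x. poly p x * poly q x * jacobi_weight \<alpha> \<beta> x)"

(* Orthogonality determines the polynomial up to a scalar factor; the value at 1 is the classical
   normalization.  For \<alpha>, \<beta> > -1 the description is satisfied by exactly one polynomial
   (lemma jacobi_poly_unique_existence below). *)
definition is_jacobi_poly :: "real \<Rightarrow> real \<Rightarrow> nat \<Rightarrow> real poly \<Rightarrow> bool" where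
  "is_jacobi_poly \<alpha> \<beta> n p \<longleftrightarrow>
     degree p = n \<and>
     (\<forall>q. degree q < n \<longrightarrow> jacobi_inner \<alpha> \<beta> p q = 0) \<and>
     poly p 1 = (real n + \<alpha>) gchoose n"

definition jacobi_poly :: "real \<Rightarrow> real \<Rightarrow> nat \<Rightarrow> real poly" where
  "jacobi_poly \<alpha> \<beta> n = (THE p. is_jacobi_poly \<alpha> \<beta> n p)"

(* The k-th smallest angle (k = 1, ..., n) in (0, pi) whose cosine is a zero of the n-th Jacobi
   polynomial; list indices start at 0, whence the shift. *)
definition jacobi_theta :: "real \<Rightarrow> real \<Rightarrow> nat \<Rightarrow> nat \<Rightarrow> real" where
  "jacobi_theta \<alpha> \<beta> n k =
     sorted_list_of_set {\<theta> \<in> {0<..<pi}. poly (jacobi_poly \<alpha> \<beta> n) (cos \<theta>) = 0} ! (k - 1)"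

definition jacobi_gamma :: "real \<Rightarrow> real \<Rightarrow> nat \<Rightarrow> real" where
  "jacobi_gamma \<alpha> \<beta> n = real n + (\<alpha> + \<beta> + 1) / 2"

definition D_down :: "(real \<times> real) set" where
  "D_down = {(\<alpha>, \<beta>). \<alpha> > -1 \<and> \<beta> > -1 \<and> \<bar>\<beta>\<bar> \<ge> 1/2 \<and> \<alpha>\<^sup>2 + 3 * \<beta>\<^sup>2 \<ge> 1}"

definition D_up :: "(real \<times> real) set" where
  "D_up = {(\<alpha>, \<beta>). \<alpha> > -1 \<and> \<beta> > -1 \<and> \<bar>\<beta>\<bar> \<le> 1/2 \<and> \<alpha>\<^sup>2 + 3 * \<beta>\<^sup>2 \<le> 1}"

context
  fixes \<alpha> \<beta> :: real
  assumes \<alpha>: "\<alpha> > -1" and \<beta>: "\<beta> > -1"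
begin

lemma jacobi_weight_integrable:
  "set_integrable lborel {-1<..<1} (jacobi_weight \<alpha> \<beta>)"
proof -
  define f where "f = (\<lambda>t::real. t powr \<beta> * (1 - t) powr \<alpha>)"
  have "(f has_integral Beta (\<beta> + 1) (\<alpha> + 1)) (cbox 0 1)"
    using has_integral_Beta_real[of "\<beta> + 1" "\<alpha> + 1"] \<alpha> \<beta> by (simp add: f_def)
  from has_integral_affinity'[OF this, of "1/2" "1/2"]
  have "(\<lambda>x. f (x / 2 + 1 / 2)) integrable_on {-1..1}"
    by (auto simp: integrable_on_def)
  then have "(\<lambda>x. f (x / 2 + 1 / 2) * 2 powr (\<alpha> + \<beta>)) integrable_on {-1..1}"
    by (rule integrable_on_mult_left)
  moreover have "f (x / 2 + 1 / 2) * 2 powr (\<alpha> + \<beta>) = jacobi_weight \<alpha> \<beta> x"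
    if "x \<in> {-1..1}" for x
  proof -
    have eq: "x / 2 + 1 / 2 = (1 + x) / 2" "1 - (1 + x) / 2 = (1 - x) / 2"
      by (auto simp: field_simps)
    have "((1 + x) / 2) powr \<beta> = (1 + x) powr \<beta> / 2 powr \<beta>"
         "((1 - x) / 2) powr \<alpha> = (1 - x) powr \<alpha> / 2 powr \<alpha>"
      using that by (auto intro!: powr_divide)
    then show ?thesis
      unfolding f_def jacobi_weight_def eq by (simp add: powr_add)
  qed
  ultimately have "jacobi_weight \<alpha> \<beta> integrable_on {-1..1}"
    by (rule integrable_eq)
  then have "jacobi_weight \<alpha> \<beta> absolutely_integrable_on {-1..1}"
    by (rule nonnegative_absolutely_integrable_1) (auto simp: jacobi_weight_def)
  then have "set_integrable lebesgue {-1<..<1} (jacobi_weight \<alpha> \<beta>)"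
    by (rule set_integrable_subset) auto
  moreover have "(\<lambda>x. indicator {-1<..<1} x *\<^sub>R jacobi_weight \<alpha> \<beta> x) \<in> borel_measurable lborel"
    unfolding jacobi_weight_def by measurable
  ultimately show ?thesis
    unfolding set_integrable_def by (simp add: integrable_completion)
qed

lemma jacobi_inner_integrable:
  "set_integrable lborel {-1<..<1} (\<lambda>x. poly p x * poly q x * jacobi_weight \<alpha> \<beta> x)"
proof -
  have "compact ((\<lambda>x. poly p x * poly q x) ` {-1..1})"
    by (intro compact_continuous_image continuous_intros) auto
  then have "bounded ((\<lambda>x. poly p x * poly q x) ` {-1..1})" by (rule compact_imp_bounded)
  then obtain C where "\<forall>y \<in> (\<lambda>x. poly p x * poly q x) ` {-1..1}. norm y \<le> C"
    unfolding bounded_iff by blast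
  then have C: "\<bar>poly p x * poly q x\<bar> \<le> C" if "x \<in> {-1..1}" for x
    using that by auto
  show ?thesis
  proof (rule set_integrable_bound)
    show "set_integrable lborel {-1<..<1} (\<lambda>x. C * jacobi_weight \<alpha> \<beta> x)"
      using jacobi_weight_integrable by simp
    have [measurable]: "(\<lambda>x. poly r x) \<in> borel_measurable borel" for r :: "real poly"
      by (intro borel_measurable_continuous_onI continuous_intros)
    show "set_borel_measurable lborel {-1<..<1}
        (\<lambda>x. poly p x * poly q x * jacobi_weight \<alpha> \<beta> x)"
      unfolding set_borel_measurable_def jacobi_weight_def by measurable
    have "\<bar>poly p x * poly q x * jacobi_weight \<alpha> \<beta> x\<bar> \<le> \<bar>C * jacobi_weight \<alpha> \<beta> x\<bar>"
      if "x \<in> {-1<..<1}" for x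
    proof -
      have "\<bar>poly p x * poly q x\<bar> \<le> \<bar>C\<bar>" using C[of x] that by force
      then show ?thesis by (simp only: abs_mult[of _ "jacobi_weight \<alpha> \<beta> x"] mult_right_mono abs_ge_zero)
    qed
    then show "AE x in lborel. x \<in> {-1<..<1} \<longrightarrow>
        norm (poly p x * poly q x * jacobi_weight \<alpha> \<beta> x) \<le> norm (C * jacobi_weight \<alpha> \<beta> x)"
      by auto
  qed
qed

lemma jacobi_inner_commute: "jacobi_inner \<alpha> \<beta> p q = jacobi_inner \<alpha> \<beta> q p"
  by (simp add: jacobi_inner_def mult_ac)

lemma jacobi_inner_add_left:
  "jacobi_inner \<alpha> \<beta> (p + q) r = jacobi_inner \<alpha> \<beta> p r + jacobi_inner \<alpha> \<beta> q r"
  using set_integral_add(2)[OF jacobi_inner_integrable[of p r] jacobi_inner_integrable[of q r]]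
  by (simp add: jacobi_inner_def algebra_simps)

lemma jacobi_inner_smult_left:
  "jacobi_inner \<alpha> \<beta> (smult c p) r = c * jacobi_inner \<alpha> \<beta> p r"
  by (simp add: jacobi_inner_def mult.assoc)

lemma jacobi_inner_diff_left:
  "jacobi_inner \<alpha> \<beta> (p - q) r = jacobi_inner \<alpha> \<beta> p r - jacobi_inner \<alpha> \<beta> q r"
  using jacobi_inner_add_left[of p "smult (-1) q" r] jacobi_inner_smult_left[of "-1" q r] by simp

lemma jacobi_inner_sum_left:
  "jacobi_inner \<alpha> \<beta> (\<Sum>i\<in>I. p i) r = (\<Sum>i\<in>I. jacobi_inner \<alpha> \<beta> (p i) r)"
proof (induction I rule: infinite_finite_induct)
  case (insert i I)
  then show ?case by (simp add: jacobi_inner_add_left)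
qed (simp_all add: jacobi_inner_def)

lemma jacobi_inner_eq_0_imp_eq_0:
  assumes nonneg: "\<And>x. x \<in> {-1<..<1} \<Longrightarrow> poly p x * poly q x \<ge> 0"
    and "jacobi_inner \<alpha> \<beta> p q = 0"
  shows "p * q = 0"
proof (rule ccontr)
  assume "p * q \<noteq> 0"
  define N where "N = {x. poly (p * q) x = 0}"
  have "finite N" using \<open>p * q \<noteq> 0\<close> unfolding N_def by (rule poly_roots_finite)
  let ?f = "\<lambda>x. indicator {-1<..<1} x *\<^sub>R (poly p x * poly q x * jacobi_weight \<alpha> \<beta> x)"
  have "AE x in lborel. ?f x = 0"
  proof (subst integral_nonneg_eq_0_iff_AE[symmetric])
    show "integrable lborel ?f"
      using jacobi_inner_integrable by (simp add: set_integrable_def)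
    show "AE x in lborel. 0 \<le> ?f x"
      using nonneg by (intro AE_I2) (auto simp: indicator_def jacobi_weight_def)
    show "integral\<^sup>L lborel ?f = 0"
      using assms(2) by (simp add: jacobi_inner_def set_lebesgue_integral_def)
  qed
  moreover have "AE x in lborel. x \<notin> N"
    using \<open>finite N\<close> by (intro AE_not_in) (simp add: finite_imp_null_set_lborel)
  ultimately have "AE x in lborel. x \<notin> {-1<..<1::real}"
  proof eventually_elim
    case (elim x)
    then show ?case by (auto simp: indicator_def N_def jacobi_weight_def)
  qed
  then have "{-1<..<1::real} \<in> null_sets lborel"
    by (subst AE_iff_null_sets) auto
  then show False by (auto simp: null_sets_def)
qed

lemma orthogonal_poly_exists:
  "\<exists>p. degree p = n \<and> p \<noteq> 0 \<and> (\<forall>q. degree q < n \<longrightarrow> jacobi_inner \<alpha> \<beta> p q = 0)"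
proof (induction n rule: less_induct)
  case (less n)
  then obtain f where
    f: "\<And>k. k < n \<Longrightarrow> degree (f k) = k" "\<And>k. k < n \<Longrightarrow> f k \<noteq> 0"
       "\<And>k q. k < n \<Longrightarrow> degree q < k \<Longrightarrow> jacobi_inner \<alpha> \<beta> (f k) q = 0"
    by metis
  have f_orth: "jacobi_inner \<alpha> \<beta> (f j) (f k) = 0" if "j < n" "k < n" "j \<noteq> k" for j k
    using that f(1,3) jacobi_inner_commute by (metis nat_neq_iff)
  have f_pos: "jacobi_inner \<alpha> \<beta> (f k) (f k) \<noteq> 0" if "k < n" for k
    using jacobi_inner_eq_0_imp_eq_0[of "f k" "f k"] f(2)[OF that] by auto
  define s where "s = (\<Sum>k<n. smult
    (jacobi_inner \<alpha> \<beta> (monom 1 n) (f k) / jacobi_inner \<alpha> \<beta> (f k) (f k)) (f k))"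
  define p where "p = monom 1 n - s"
  have "coeff s i = 0" if "i \<ge> n" for i
    using that f(1) by (auto simp: s_def coeff_sum coeff_eq_0 intro!: sum.neutral)
  then have "coeff p n = 1" "\<And>i. i > n \<Longrightarrow> coeff p i = 0" by (auto simp: p_def)
  then have deg: "degree p = n" "p \<noteq> 0"
    by (metis le_antisym le_degree degree_le zero_neq_one, metis coeff_0 zero_neq_one)
  have p_f: "jacobi_inner \<alpha> \<beta> p (f k) = 0" if "k < n" for k
  proof -
    have "jacobi_inner \<alpha> \<beta> s (f k) = (\<Sum>j<n. if j = k then jacobi_inner \<alpha> \<beta> (monom 1 n) (f k) else 0)"
      unfolding s_def jacobi_inner_sum_left jacobi_inner_smult_left
      using that f_orth f_pos by (intro sum.cong) auto
    then show ?thesis using that by (simp add: p_def jacobi_inner_diff_left)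
  qed
  have "jacobi_inner \<alpha> \<beta> q p = 0" if "degree q < n" for q
    using that
  proof (induction "degree q" arbitrary: q rule: less_induct)
    case less
    define d where "d = degree q"
    define r where "r = q - smult (lead_coeff q / lead_coeff (f d)) (f d)"
    have "d < n" using less.prems by (simp add: d_def)
    have "degree r \<le> d" unfolding r_def
      using f(1)[OF \<open>d < n\<close>] by (intro degree_diff_le) (auto simp: d_def degree_smult_le)
    moreover have "coeff r d = 0"
    proof -
      have "coeff (f d) d \<noteq> 0" using f(1,2)[OF \<open>d < n\<close>] leading_coeff_0_iff by metis
      then show ?thesis by (simp add: r_def f(1)[OF \<open>d < n\<close>]) (simp add: d_def)
    qed
    ultimately have "r = 0 \<or> degree r < d"
      by (metis le_neq_implies_less leading_coeff_0_iff)
    then have "jacobi_inner \<alpha> \<beta> r p = 0"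
      using less.hyps[of r] \<open>d < n\<close> by (auto simp: d_def jacobi_inner_def)
    moreover have "jacobi_inner \<alpha> \<beta> (f d) p = 0"
      using p_f[OF \<open>d < n\<close>] by (simp add: jacobi_inner_commute)
    ultimately show ?case
      by (simp add: r_def jacobi_inner_diff_left jacobi_inner_smult_left)
  qed
  then show ?case using deg jacobi_inner_commute by metis
qed

lemma jacobi_poly_unique_existence: "\<exists>!p. is_jacobi_poly \<alpha> \<beta> n p"
proof -
  define c where "c = (real n + \<alpha>) gchoose n"
  have "c \<noteq> 0"
    using \<alpha> by (auto simp: c_def gbinomial_prod_rev)
  obtain p where p: "degree p = n" "p \<noteq> 0" "\<And>q. degree q < n \<Longrightarrow> jacobi_inner \<alpha> \<beta> p q = 0"
    using orthogonal_poly_exists by metis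
  have "poly p 1 \<noteq> 0"
  proof
    assume "poly p 1 = 0"
    then obtain q where q: "p = [:-1, 1:] * q" by (metis poly_eq_0_iff_dvd dvdE)
    then have "q \<noteq> 0" using p(2) by auto
    then have "degree q < n" using p(1) by (simp add: q degree_mult_eq del: mult_pCons_left)
    then have "jacobi_inner \<alpha> \<beta> p (- q) = 0" by (intro p(3)) simp
    moreover have "poly p x * poly (- q) x \<ge> 0" if "x \<in> {-1<..<1}" for x
    proof -
      have "poly p x * poly (- q) x = (1 - x) * (poly q x)\<^sup>2"
        by (simp add: q algebra_simps power2_eq_square)
      then show ?thesis using that by simp
    qed
    ultimately have "p * (- q) = 0" by (intro jacobi_inner_eq_0_imp_eq_0)
    then show False using p(2) \<open>q \<noteq> 0\<close> by simp
  qed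
  then have ex: "is_jacobi_poly \<alpha> \<beta> n (smult (c / poly p 1) p)"
    using p \<open>c \<noteq> 0\<close> by (simp add: is_jacobi_poly_def jacobi_inner_smult_left flip: c_def)
  have "u = v" if u: "is_jacobi_poly \<alpha> \<beta> n u" and v: "is_jacobi_poly \<alpha> \<beta> n v" for u v
  proof -
    define r where "r = smult (lead_coeff v) u - smult (lead_coeff u) v"
    have uv: "degree u = n" "degree v = n" "poly u 1 = c" "poly v 1 = c"
      using u v by (auto simp: is_jacobi_poly_def c_def)
    then have "degree r \<le> n" unfolding r_def by (intro degree_diff_le) (auto simp: degree_smult_le)
    moreover have "coeff r n = 0" using uv by (simp add: r_def)
    ultimately have "r = 0 \<or> degree r < n" by (metis le_neq_implies_less leading_coeff_0_iff)
    moreover have "jacobi_inner \<alpha> \<beta> r r = 0" if "degree r < n"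
      using that u v unfolding r_def
      by (simp add: jacobi_inner_diff_left jacobi_inner_smult_left is_jacobi_poly_def)
    ultimately have "r = 0" using jacobi_inner_eq_0_imp_eq_0[of r r] by auto
    then have "poly r 1 = 0" by simp
    then have "lead_coeff u = lead_coeff v" using uv \<open>c \<noteq> 0\<close> by (simp add: r_def algebra_simps)
    moreover have "lead_coeff v \<noteq> 0"
      using uv(4) \<open>c \<noteq> 0\<close> leading_coeff_0_iff[of v] by force
    ultimately show "u = v" using \<open>r = 0\<close> by (simp add: r_def flip: smult_diff_right)
  qed
  then show ?thesis using ex by blast
qed

end

end

theory Submission
  imports Defs "HOL-Real_Asymp.Real_Asymp"
begin

text \<open>
  Put \<open>t = \<phi> / (2 \<gamma>\<^sub>n)\<close>, \<open>A = 1/4 - \<alpha>\<^sup>2\<close>, \<open>B = 1/4 - \<beta>\<^sup>2\<close>.  The function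
  \<open>u\<^sub>n(\<phi>) = (sin t)^(\<alpha> + 1/2) (cos t)^(\<beta> + 1/2) P\<^sub>n(cos (\<phi> / \<gamma>\<^sub>n))\<close> has the zeros
  \<open>\<gamma>\<^sub>n \<theta>\<^sub>n\<^sub>,\<^sub>k\<close> in \<open>(0, \<gamma>\<^sub>n \<pi>)\<close>, and the Jacobi differential equation becomes
  \<open>u\<^sub>n'' + (1 + F(t) / \<phi>\<^sup>2) u\<^sub>n = 0\<close> with \<open>F(t) = A t\<^sup>2 / sin\<^sup>2 t + B t\<^sup>2 / cos\<^sup>2 t\<close>
  (\<open>jacobi_u_solves\<close>).  The degree enters the coefficient only through \<open>t\<close>, and \<open>t\<close> decreases when
  \<open>n\<close> grows.  Hence, if \<open>F\<close> is increasing on \<open>(0, \<pi>/2)\<close>, passing from \<open>n\<close> to \<open>n + 1\<close> lowers the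
  coefficient, the solution oscillates more slowly, and every scaled zero moves to the right; if \<open>F\<close>
  is decreasing, every scaled zero moves to the left.  This is Sturm's comparison theorem
  (\<open>sturm_comparison\<close>), used on an interval whose left end \<open>0\<close> is a singular point: there the
  Wronskian of \<open>u\<^sub>m\<close> and \<open>u\<^sub>n\<close> is of order \<open>\<phi>^(2 \<alpha> + 2)\<close> and so tends to \<open>0\<close> exactly because
  \<open>\<alpha> > -1\<close> (\<open>jacobi_wronskian_at_0\<close>).

  The derivative of \<open>t\<^sup>2 / cos\<^sup>2 t\<close> is at least three times the derivative of \<open>t\<^sup>2 / sin\<^sup>2 t\<close>, which
  is nonnegative, so \<open>F\<close> is increasing when \<open>B \<ge> 0\<close> and \<open>A + 3 B \<ge> 0\<close>
  and decreasing when both inequalities are reversed (\<open>potential_mono\<close>, \<open>potential_antimono\<close>).  These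
  two pairs of inequalities are the regions \<open>D_up\<close> and \<open>D_down\<close>, which proves sufficiency.

  For necessity each of the two inequalities is tested at one end of the interval.
  Near \<open>t = 0\<close> the sign of \<open>F'\<close> is that of \<open>A + 3 B\<close>, if this is not zero.  Since \<open>\<gamma>\<^sub>n \<theta>\<^sub>n\<^sub>,\<^sub>1\<close> stays bounded, for large \<open>n\<close> the
  first scaled zero only sees small \<open>t\<close>, and a strict Sturm comparison decides the order of
  \<open>\<gamma>\<^sub>n \<theta>\<^sub>n\<^sub>,\<^sub>1\<close> and \<open>\<gamma>\<^sub>n\<^sub>+\<^sub>1 \<theta>\<^sub>n\<^sub>+\<^sub>1\<^sub>,\<^sub>1\<close> (\<open>first_theta_comparison\<close>).
  Near \<open>\<phi> = \<gamma>\<^sub>n \<pi>\<close>, with \<open>s = \<gamma>\<^sub>n \<pi> - \<phi>\<close>, the coefficient is close to \<open>1 + B / s\<^sup>2\<close>, so the gap between the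
  last two scaled zeros differs from \<open>\<pi>\<close> by at least a constant \<open>c > 0\<close> whose direction is given by the
  sign of \<open>B\<close> (\<open>last_gap\<close>).  Let \<open>s\<^sub>n\<close> be the distance of the last scaled zero from \<open>\<gamma>\<^sub>n \<pi>\<close>.  Because
  \<open>\<gamma>\<^sub>n\<^sub>+\<^sub>1 \<pi> = \<gamma>\<^sub>n \<pi> + \<pi>\<close>, monotonicity of the wrong kind for \<open>k = n\<close> would force \<open>s\<^sub>n\<close> to drift by at
  least \<open>c\<close> at every step, although \<open>s\<^sub>n\<close> is bounded (\<open>last_theta_comparison\<close>).
\<close>

section \<open>Sturm comparison with a possibly singular left endpoint\<close>

text \<open>
  The equation \<open>u'' + q u = 0\<close> as a first order system; \<open>v\<close> is the derivative of \<open>u\<close>.  The derivatives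
  are two-sided, also at endpoints of \<open>I\<close>.
\<close>
definition solves_on ::
  "(real \<Rightarrow> real) \<Rightarrow> (real \<Rightarrow> real) \<Rightarrow> (real \<Rightarrow> real) \<Rightarrow> real set \<Rightarrow> bool" where
  "solves_on q u v I \<longleftrightarrow>
     (\<forall>x\<in>I. (u has_real_derivative v x) (at x) \<and> (v has_real_derivative - q x * u x) (at x))"

lemma solves_onD:
  assumes "solves_on q u v I" "x \<in> I"
  shows "(u has_real_derivative v x) (at x)" "(v has_real_derivative - q x * u x) (at x)"
  using assms by (auto simp: solves_on_def)

lemma solves_on_subset: "solves_on q u v I \<Longrightarrow> J \<subseteq> I \<Longrightarrow> solves_on q u v J"
  by (auto simp: solves_on_def)

lemma solves_on_cmult:
  assumes "solves_on q u v I"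
  shows "solves_on q (\<lambda>x. c * u x) (\<lambda>x. c * v x) I"
  unfolding solves_on_def
proof safe
  fix x assume "x \<in> I"
  note d = solves_onD[OF assms this]
  show "((\<lambda>x. c * u x) has_real_derivative c * v x) (at x)"
    using DERIV_cmult[OF d(1)] .
  show "((\<lambda>x. c * v x) has_real_derivative - q x * (c * u x)) (at x)"
    using DERIV_cmult[OF d(2), of c] by (simp add: algebra_simps)
qed

lemma solves_on_sin: "solves_on (\<lambda>_. w\<^sup>2) (\<lambda>x. sin (w * (x - a))) (\<lambda>x. w * cos (w * (x - a))) I"
  unfolding solves_on_def by (auto intro!: derivative_eq_intros simp: power2_eq_square)

lemma solves_on_continuous:
  assumes "solves_on q u v I" shows "continuous_on I u"
  using DERIV_continuous_on[of I u v] has_field_derivative_at_within solves_onD[OF assms] by blast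

lemma nonvanishing_constant_sign:
  fixes u :: "real \<Rightarrow> real"
  assumes "continuous_on {a<..<b} u" "\<And>x. x \<in> {a<..<b} \<Longrightarrow> u x \<noteq> 0"
  obtains c where "c = 1 \<or> c = -1" "\<And>x. x \<in> {a<..<b} \<Longrightarrow> c * u x > 0"
proof -
  have conn: "connected (u ` {a<..<b})"
    by (intro connected_continuous_image assms connected_Ioo)
  have "(\<forall>x\<in>{a<..<b}. u x > 0) \<or> (\<forall>x\<in>{a<..<b}. u x < 0)"
  proof (rule ccontr)
    assume "\<not> ?thesis"
    then obtain x y where xy: "x \<in> {a<..<b}" "y \<in> {a<..<b}" "u x \<le> 0" "u y \<ge> 0" by force
    then have "0 \<in> u ` {a<..<b}" using connectedD_interval[OF conn, of "u x" "u y" 0] by blast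
    then show False using assms(2) by force
  qed
  then show thesis using that[of 1] that[of "-1"] by auto
qed

text \<open>
  The derivative of the Wronskian \<open>u\<^sub>1 v\<^sub>2 - v\<^sub>1 u\<^sub>2\<close> is \<open>(q\<^sub>1 - q\<^sub>2) u\<^sub>1 u\<^sub>2\<close>.  Only the one-sided limit at
  \<open>a\<close> is used, so the equation may be singular there.
\<close>
lemma wronskian_decreasing:
  assumes ab: "a < b" and S: "solves_on q1 u1 v1 {a<..b}" "solves_on q2 u2 v2 {a<..b}"
    and pos: "\<And>x. x \<in> {a<..<b} \<Longrightarrow> u1 x > 0" "\<And>x. x \<in> {a<..<b} \<Longrightarrow> u2 x > 0"
    and le: "\<And>x. x \<in> {a<..<b} \<Longrightarrow> q1 x \<le> q2 x"
    and lim: "((\<lambda>x. u1 x * v2 x - v1 x * u2 x) \<longlongrightarrow> L) (at_right a)"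
  shows "u1 b * v2 b - v1 b * u2 b \<le> L"
    and "(\<And>x. x \<in> {a<..<b} \<Longrightarrow> q1 x < q2 x) \<Longrightarrow> u1 b * v2 b - v1 b * u2 b < L"
proof -
  define W where "W = (\<lambda>x. u1 x * v2 x - v1 x * u2 x)"
  have dW: "(W has_real_derivative (q1 x - q2 x) * (u1 x * u2 x)) (at x)" if "x \<in> {a<..b}" for x
    unfolding W_def using solves_onD[OF S(1) that] solves_onD[OF S(2) that]
    by (auto intro!: derivative_eq_intros simp: algebra_simps)
  have cont: "continuous_on {x..y} W" if "a < x" "y \<le> b" for x y
    using that by (intro DERIV_continuous_on[OF has_field_derivative_at_within[OF dW]]) auto
  have mono: "W y \<le> W x" if "a < x" "x \<le> y" "y \<le> b" for x y
  proof (rule DERIV_nonpos_imp_decreasing_open[OF that(2) _ cont])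
    fix z assume z: "x < z" "z < y"
    then have "(q1 z - q2 z) * (u1 z * u2 z) \<le> 0"
      using that le[of z] pos[of z] by (intro mult_nonpos_nonneg) auto
    then show "\<exists>d. DERIV W z :> d \<and> d \<le> 0" using dW[of z] z that by auto
  qed (use that in auto)
  have lim': "(W \<longlongrightarrow> L) (at_right a)" using lim by (simp add: W_def)
  have bound: "W y \<le> L" if "a < y" "y \<le> b" for y
  proof (rule tendsto_lowerbound[OF lim'])
    show "\<forall>\<^sub>F x in at_right a. W y \<le> W x"
      using eventually_at_right_real[OF that(1)] by eventually_elim (use that in \<open>auto intro: mono\<close>)
  qed auto
  show "u1 b * v2 b - v1 b * u2 b \<le> L" using bound[of b] ab by (simp add: W_def)
  assume lt: "\<And>x. x \<in> {a<..<b} \<Longrightarrow> q1 x < q2 x"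
  define c where "c = (a + b) / 2"
  have c: "a < c" "c < b" using ab by (auto simp: c_def)
  have "W b < W c"
  proof (rule DERIV_neg_imp_decreasing_open[OF c(2) _ cont])
    fix z assume z: "c < z" "z < b"
    then have "(q1 z - q2 z) * (u1 z * u2 z) < 0"
      using c lt[of z] pos[of z] by (intro mult_neg_pos) auto
    then show "\<exists>d. DERIV W z :> d \<and> d < 0" using dW[of z] z c by auto
  qed (use c in auto)
  also have "W c \<le> L" using bound c by auto
  finally show "u1 b * v2 b - v1 b * u2 b < L" by (simp add: W_def)
qed

text \<open>
  If \<open>u\<^sub>2\<close> had no zero, both functions could be taken positive on \<open>(a, b)\<close>.  The Wronskian is then at most
  \<open>0\<close> at \<open>a\<close> and decreases, but at \<open>b\<close> it equals \<open>- v\<^sub>1(b) u\<^sub>2(b)\<close>, which is nonnegative because \<open>u\<^sub>1\<close>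
  falls to its zero there, and positive if \<open>u\<^sub>2(b) \<noteq> 0\<close>.  If \<open>q\<^sub>1 < q\<^sub>2\<close>, the Wronskian decreases
  strictly, and \<open>b\<close> itself can be excluded.  The left endpoint is either a zero of \<open>u\<^sub>1\<close> or a singular point at which the
  Wronskian vanishes.
\<close>
theorem sturm_comparison:
  assumes ab: "a < b" and S: "solves_on q1 u1 v1 {a<..b}" "solves_on q2 u2 v2 {a<..b}"
    and left: "((\<lambda>x. u1 x * v2 x - v1 x * u2 x) \<longlongrightarrow> 0) (at_right a) \<or>
       solves_on q1 u1 v1 {a} \<and> solves_on q2 u2 v2 {a} \<and> u1 a = 0"
    and nz: "\<And>x. x \<in> {a<..<b} \<Longrightarrow> u1 x \<noteq> 0" and zero: "u1 b = 0" "v1 b \<noteq> 0"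
    and le: "\<And>x. x \<in> {a<..<b} \<Longrightarrow> q1 x \<le> q2 x"
  shows "\<exists>x\<in>{a<..b}. u2 x = 0"
    and "(\<And>x. x \<in> {a<..<b} \<Longrightarrow> q1 x < q2 x) \<Longrightarrow> \<exists>x\<in>{a<..<b}. u2 x = 0"
proof -
  have main: "u2 b = 0 \<and> \<not> (\<forall>x\<in>{a<..<b}. q1 x < q2 x)" if nz2: "\<And>x. x \<in> {a<..<b} \<Longrightarrow> u2 x \<noteq> 0"
  proof -
    have sub: "{a<..<b} \<subseteq> {a<..b}" by auto
    obtain c where c: "c = 1 \<or> c = -1" "\<And>x. x \<in> {a<..<b} \<Longrightarrow> c * u1 x > 0"
      using nonvanishing_constant_sign[of a b u1] nz
        continuous_on_subset[OF solves_on_continuous[OF S(1)] sub] by metis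
    obtain d where d: "d = 1 \<or> d = -1" "\<And>x. x \<in> {a<..<b} \<Longrightarrow> d * u2 x > 0"
      using nonvanishing_constant_sign[of a b u2] nz2
        continuous_on_subset[OF solves_on_continuous[OF S(2)] sub] by metis
    \<comment> \<open>Scaling by constant signs makes both solutions positive inside the interval.\<close>
    define U1 V1 U2 V2 where UV: "U1 = (\<lambda>x. c * u1 x)" "V1 = (\<lambda>x. c * v1 x)"
      "U2 = (\<lambda>x. d * u2 x)" "V2 = (\<lambda>x. d * v2 x)"
    have T: "solves_on q1 U1 V1 {a<..b}" "solves_on q2 U2 V2 {a<..b}"
      unfolding UV by (intro solves_on_cmult S)+
    have pos: "U1 x > 0" "U2 x > 0" if "x \<in> {a<..<b}" for x
      using c d that by (auto simp: UV)
    have ev: "\<forall>\<^sub>F x in at_right a. x \<in> {a<..<b}" "\<forall>\<^sub>F x in at_left b. x \<in> {a<..<b}"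
      using eventually_at_right_real[OF ab] eventually_at_left_real[OF ab] by auto
    have "\<exists>L\<le>0. ((\<lambda>x. U1 x * V2 x - V1 x * U2 x) \<longlongrightarrow> L) (at_right a)"
      using left
    proof
      assume "((\<lambda>x. u1 x * v2 x - v1 x * u2 x) \<longlongrightarrow> 0) (at_right a)"
      from tendsto_mult_right[OF this, of "c * d"]
      show ?thesis by (intro exI[of _ 0]) (simp add: UV algebra_simps)
    next
      assume A: "solves_on q1 u1 v1 {a} \<and> solves_on q2 u2 v2 {a} \<and> u1 a = 0"
      then have B: "solves_on q1 U1 V1 {a}" "solves_on q2 U2 V2 {a}" "U1 a = 0"
        unfolding UV by (auto intro: solves_on_cmult)
      have lim: "(U1 \<longlongrightarrow> U1 a) (at_right a)" "(V1 \<longlongrightarrow> V1 a) (at_right a)"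
        "(U2 \<longlongrightarrow> U2 a) (at_right a)" "(V2 \<longlongrightarrow> V2 a) (at_right a)"
        by (intro filterlim_mono[OF isContD[OF DERIV_isCont[OF solves_onD(1)[OF B(1)]]] order_refl at_le]
            filterlim_mono[OF isContD[OF DERIV_isCont[OF solves_onD(2)[OF B(1)]]] order_refl at_le]
            filterlim_mono[OF isContD[OF DERIV_isCont[OF solves_onD(1)[OF B(2)]]] order_refl at_le]
            filterlim_mono[OF isContD[OF DERIV_isCont[OF solves_onD(2)[OF B(2)]]] order_refl at_le]; simp)+
      have "U2 a \<ge> 0"
        using pos by (intro tendsto_lowerbound[OF lim(3)] eventually_mono[OF ev(1)]) (auto intro: less_imp_le)
      moreover have "V1 a \<ge> 0"
      proof -
        have "((\<lambda>x. (U1 x - U1 a) / (x - a)) \<longlongrightarrow> V1 a) (at_right a)"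
          using has_field_derivative_at_within[OF solves_onD(1)[OF B(1)], of a]
          by (simp add: has_field_derivative_iff)
        then show ?thesis
          using pos B(3) by (elim tendsto_lowerbound) (auto intro!: eventually_mono[OF ev(1)] divide_nonneg_pos simp: less_imp_le)
      qed
      ultimately have "U1 a * V2 a - V1 a * U2 a \<le> 0" using B(3) by simp
      moreover have "((\<lambda>x. U1 x * V2 x - V1 x * U2 x) \<longlongrightarrow> U1 a * V2 a - V1 a * U2 a) (at_right a)"
        by (intro tendsto_intros lim)
      ultimately show ?thesis by blast
    qed
    then obtain L where L: "L \<le> 0" "((\<lambda>x. U1 x * V2 x - V1 x * U2 x) \<longlongrightarrow> L) (at_right a)" by blast
    note dec = wronskian_decreasing[OF ab T pos le L(2)]
    have U1b: "U1 b = 0" using zero by (simp add: UV)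
    \<comment> \<open>A function that is positive before its zero has a nonpositive derivative there.\<close>
    have "V1 b \<le> 0"
    proof -
      have "((\<lambda>x. (U1 x - U1 b) / (x - b)) \<longlongrightarrow> V1 b) (at_left b)"
        using has_field_derivative_at_within[OF solves_onD(1)[OF T(1)], of b] ab
        by (simp add: has_field_derivative_iff)
      then show ?thesis
        using pos U1b by (elim tendsto_upperbound) (auto intro!: eventually_mono[OF ev(2)] divide_nonneg_neg simp: less_imp_le)
    qed
    then have V1b: "V1 b < 0" using zero c(1) by (auto simp: UV)
    have "U2 b \<ge> 0"
    proof -
      have "(U2 \<longlongrightarrow> U2 b) (at_left b)"
        using ab by (intro filterlim_mono[OF isContD[OF DERIV_isCont[OF solves_onD(1)[OF T(2)]]] order_refl at_le]) auto
      then show ?thesis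
        using pos by (elim tendsto_lowerbound) (auto intro!: eventually_mono[OF ev(2)] less_imp_le)
    qed
    then have "V1 b * U2 b \<le> 0" using V1b by (simp add: mult_nonpos_nonneg)
    moreover have "V1 b * U2 b \<ge> 0" using dec(1) L(1) U1b by simp
    moreover have "V1 b * U2 b > 0" if "\<forall>x\<in>{a<..<b}. q1 x < q2 x" using dec(2) that L(1) U1b by simp
    ultimately show ?thesis using V1b d(1) by (auto simp: UV)
  qed
  show "\<exists>x\<in>{a<..b}. u2 x = 0"
  proof (cases "\<exists>x\<in>{a<..<b}. u2 x = 0")
    case False
    then show ?thesis using main ab by (intro bexI[of _ b]) auto
  qed auto
  show "\<exists>x\<in>{a<..<b}. u2 x = 0" if "\<And>x. x \<in> {a<..<b} \<Longrightarrow> q1 x < q2 x"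
    using main that by blast
qed

section \<open>The differential equation and the zeros of Jacobi polynomials\<close>

text \<open>
  The polynomial \<open>(W r)' / w\<close>, where \<open>w\<close> is the Jacobi weight and \<open>W(x) = (1 - x\<^sup>2) w(x)\<close>.  For
  \<open>r = p'\<close> it is the Jacobi differential operator applied to \<open>p\<close>.
\<close>
definition jacobi_div :: "real \<Rightarrow> real \<Rightarrow> real poly \<Rightarrow> real poly" where
  "jacobi_div \<alpha> \<beta> r = [:1, 0, -1:] * pderiv r + [:\<beta> - \<alpha>, - (\<alpha> + \<beta> + 2):] * r"

text \<open>
  The Jacobi operator does not raise degrees and acts on the monomial of degree \<open>i\<close> with the diagonal
  entry \<open>- i (i + \<alpha> + \<beta> + 1)\<close>, the future eigenvalue.
\<close>
lemma coeff_jacobi_div_pderiv: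
  "coeff (jacobi_div \<alpha> \<beta> (pderiv p)) i =
     (real i + 2) * (real i + 1) * coeff p (i + 2) + (\<beta> - \<alpha>) * (real i + 1) * coeff p (i + 1)
     - real i * (real i + \<alpha> + \<beta> + 1) * coeff p i"
proof -
  consider "i = 0" | "i = Suc 0" | j where "i = Suc (Suc j)" by (metis not0_implies_Suc)
  then show ?thesis
    by cases (simp_all add: jacobi_div_def coeff_pderiv algebra_simps)
qed

lemma degree_jacobi_div_pderiv: "degree (jacobi_div \<alpha> \<beta> (pderiv p)) \<le> degree p"
  by (intro degree_le) (simp add: coeff_jacobi_div_pderiv coeff_eq_0)

lemma linear_factors_dvd:
  fixes p :: "real poly"
  assumes "finite S" "\<And>z. z \<in> S \<Longrightarrow> poly p z = 0"
  shows "(\<Prod>z\<in>S. [:-z, 1:]) dvd p"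
  using assms
proof (induction S arbitrary: p)
  case (insert a S)
  obtain h where h: "p = [:-a, 1:] * h" using insert.prems by (metis poly_eq_0_iff_dvd dvdE insertI1)
  have "poly h z = 0" if "z \<in> S" for z
    using insert.prems[of z] insert.hyps that by (auto simp: h)
  then have "(\<Prod>z\<in>S. [:-z, 1:]) dvd h" by (rule insert.IH)
  then have "[:-a, 1:] * (\<Prod>z\<in>S. [:-z, 1:]) dvd p" unfolding h by (rule mult_dvd_mono[OF dvd_refl])
  then show ?case using insert.hyps by (simp add: prod.insert del: mult_pCons_left)
qed simp

context
  fixes \<alpha> \<beta> :: real
  assumes \<alpha>: "\<alpha> > -1" and \<beta>: "\<beta> > -1"
begin

text \<open>
  This is integration by parts: the integrand is an exact derivative, and its primitive \<open>W r\<close> vanishes at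
  \<open>-1\<close> and \<open>1\<close> since the exponents \<open>\<alpha> + 1\<close> and \<open>\<beta> + 1\<close> are positive.
\<close>
lemma jacobi_inner_jacobi_div: "jacobi_inner \<alpha> \<beta> (jacobi_div \<alpha> \<beta> r) 1 = 0"
proof -
  define W where "W = (\<lambda>x. (1 - x) powr (\<alpha> + 1) * (1 + x) powr (\<beta> + 1) * poly r x)"
  define f where "f = (\<lambda>x. poly (jacobi_div \<alpha> \<beta> r) x * poly 1 x * jacobi_weight \<alpha> \<beta> x)"
  have dW: "(W has_vector_derivative f x) (at x)" if x: "x \<in> {-1<..<1}" for x
  proof -
    have 1: "((\<lambda>x. (1 - x) powr (\<alpha> + 1)) has_real_derivative - ((\<alpha> + 1) * (1 - x) powr \<alpha>)) (at x)"
      using x by (auto intro!: derivative_eq_intros DERIV_powr simp: powr_diff field_simps)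
    have 2: "((\<lambda>x. (1 + x) powr (\<beta> + 1)) has_real_derivative (\<beta> + 1) * (1 + x) powr \<beta>) (at x)"
      using x by (auto intro!: derivative_eq_intros simp: powr_diff field_simps)
    have p: "(1 - x) powr (\<alpha> + 1) = (1 - x) * (1 - x) powr \<alpha>"
      "(1 + x) powr (\<beta> + 1) = (1 + x) * (1 + x) powr \<beta>"
      using x by (simp_all add: powr_add)
    have "(W has_real_derivative f x) (at x)"
      unfolding W_def
      by (rule DERIV_cong[OF DERIV_mult[OF DERIV_mult[OF 1 2] poly_DERIV]])
        (unfold p f_def jacobi_div_def jacobi_weight_def, simp add: algebra_simps)
    then show ?thesis by (simp add: has_real_derivative_iff_has_vector_derivative)
  qed
  have "continuous_on {-1..1} W"
    unfolding W_def using \<alpha> \<beta> by (intro continuous_intros continuous_on_powr') auto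
  then have "(f has_integral (W 1 - W (-1))) {-1..1}"
    by (intro fundamental_theorem_of_calculus_interior dW) auto
  then have "(f has_integral 0) {-1..1}" using \<alpha> \<beta> by (simp add: W_def)
  then have "(f has_integral 0) {-1<..<1}" by (simp add: has_integral_Icc_iff_Ioo)
  moreover have "set_lebesgue_integral lborel {-1<..<1} f = integral {-1<..<1} f"
    unfolding f_def by (intro set_borel_integral_eq_integral jacobi_inner_integrable \<alpha> \<beta>)
  ultimately show ?thesis by (simp add: jacobi_inner_def f_def integral_unique)
qed

text \<open>
  The difference of both sides is the integral of \<open>jacobi_div\<close> of \<open>p' q - p q'\<close>, because the terms with
  \<open>p' q'\<close> cancel.
\<close>
lemma jacobi_operator_symmetric:
  "jacobi_inner \<alpha> \<beta> (jacobi_div \<alpha> \<beta> (pderiv p)) q = jacobi_inner \<alpha> \<beta> p (jacobi_div \<alpha> \<beta> (pderiv q))"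
proof -
  let ?L = "\<lambda>p. jacobi_div \<alpha> \<beta> (pderiv p)"
  have "jacobi_div \<alpha> \<beta> (pderiv p * q - p * pderiv q) = ?L p * q - p * ?L q"
    by (simp only: jacobi_div_def pderiv_diff pderiv_mult ring_distribs mult_ac add_ac)
  then have "jacobi_inner \<alpha> \<beta> (?L p * q - p * ?L q) 1 = 0"
    using jacobi_inner_jacobi_div[of "pderiv p * q - p * pderiv q"] by simp
  then show ?thesis
    unfolding jacobi_inner_diff_left[OF \<alpha> \<beta>] by (simp add: jacobi_inner_def)
qed

lemma is_jacobi_poly_jacobi_poly: "is_jacobi_poly \<alpha> \<beta> n (jacobi_poly \<alpha> \<beta> n)"
  unfolding jacobi_poly_def by (rule theI'[OF jacobi_poly_unique_existence[OF \<alpha> \<beta>]])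

lemma degree_jacobi_poly: "degree (jacobi_poly \<alpha> \<beta> n) = n"
  and jacobi_poly_orthogonal: "degree q < n \<Longrightarrow> jacobi_inner \<alpha> \<beta> (jacobi_poly \<alpha> \<beta> n) q = 0"
  using is_jacobi_poly_jacobi_poly[of n] by (auto simp: is_jacobi_poly_def)

lemma jacobi_poly_nonzero: "jacobi_poly \<alpha> \<beta> n \<noteq> 0"
proof
  assume "jacobi_poly \<alpha> \<beta> n = 0"
  moreover have "poly (jacobi_poly \<alpha> \<beta> n) 1 = (real n + \<alpha>) gchoose n"
    using is_jacobi_poly_jacobi_poly[of n] by (simp add: is_jacobi_poly_def)
  ultimately have "(real n + \<alpha>) gchoose n = 0" by simp
  then show False using \<alpha> by (auto simp: gbinomial_prod_rev)
qed

text \<open>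
  The Jacobi operator does not raise degrees and is symmetric, so it maps the \<open>n\<close>-th orthogonal polynomial
  to a polynomial orthogonal to all lower degrees.  After the leading coefficient has been
  cancelled, the rest has degree below \<open>n\<close> and is orthogonal to itself.
\<close>
theorem jacobi_poly_ode:
  fixes n x defines "P \<equiv> jacobi_poly \<alpha> \<beta> n"
  shows "(1 - x\<^sup>2) * poly (pderiv (pderiv P)) x + (\<beta> - \<alpha> - (\<alpha> + \<beta> + 2) * x) * poly (pderiv P) x
    + real n * (real n + \<alpha> + \<beta> + 1) * poly P x = 0"
proof -
  define r where "r = jacobi_div \<alpha> \<beta> (pderiv P) + smult (real n * (real n + \<alpha> + \<beta> + 1)) P"
  have degP: "degree P = n" by (simp add: P_def degree_jacobi_poly)
  have "degree r \<le> n"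
    unfolding r_def using degree_jacobi_div_pderiv[of \<alpha> \<beta> P] degP
    by (intro degree_add_le) (auto simp: degree_smult_le)
  moreover have "coeff r n = 0"
    by (simp add: r_def coeff_jacobi_div_pderiv coeff_eq_0 degP)
  ultimately have deg: "r = 0 \<or> degree r < n" by (metis le_neq_implies_less leading_coeff_0_iff)
  have "jacobi_inner \<alpha> \<beta> r q = 0" if "degree q < n" for q
  proof -
    have "degree (jacobi_div \<alpha> \<beta> (pderiv q)) < n"
      using degree_jacobi_div_pderiv[of \<alpha> \<beta> q] that by simp
    then show ?thesis
      using that by (simp add: r_def P_def jacobi_inner_add_left[OF \<alpha> \<beta>] jacobi_inner_smult_left[OF \<alpha> \<beta>]
          jacobi_operator_symmetric jacobi_poly_orthogonal)
  qed
  then have "r = 0" using deg jacobi_inner_eq_0_imp_eq_0[OF \<alpha> \<beta>, of r r] by auto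
  then have "poly r x = 0" by simp
  then show ?thesis by (simp add: r_def jacobi_div_def algebra_simps power2_eq_square)
qed

text \<open>
  If \<open>(x - z)\<^sup>2 g\<close> were orthogonal to all lower degrees, then pairing it with \<open>g\<close> would give the integral
  of the square \<open>((x - z) g)\<^sup>2\<close>.
\<close>
lemma jacobi_poly_simple_root:
  assumes "poly (jacobi_poly \<alpha> \<beta> n) z = 0"
  shows "poly (pderiv (jacobi_poly \<alpha> \<beta> n)) z \<noteq> 0"
proof
  assume "poly (pderiv (jacobi_poly \<alpha> \<beta> n)) z = 0"
  moreover obtain h where h: "jacobi_poly \<alpha> \<beta> n = [:-z, 1:] * h"
    using assms by (metis poly_eq_0_iff_dvd dvdE)
  ultimately have "poly h z = 0"
    by (simp only: h pderiv_mult poly_add poly_mult) (simp add: pderiv_pCons)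
  then obtain g where "h = [:-z, 1:] * g" by (metis poly_eq_0_iff_dvd dvdE)
  then have eq: "jacobi_poly \<alpha> \<beta> n = [:-z, 1:]^2 * g" by (simp only: h power2_eq_square mult.assoc)
  then have "g \<noteq> 0" using jacobi_poly_nonzero by force
  then have "n = 2 + degree g"
    using degree_jacobi_poly[of n] by (simp only: eq degree_mult_eq degree_linear_power) (simp add: degree_mult_eq degree_linear_power)
  then have "jacobi_inner \<alpha> \<beta> (jacobi_poly \<alpha> \<beta> n) g = 0" by (intro jacobi_poly_orthogonal) simp
  moreover have "poly (jacobi_poly \<alpha> \<beta> n) x * poly g x \<ge> 0" for x
  proof -
    have "poly (jacobi_poly \<alpha> \<beta> n) x * poly g x = ((x - z) * poly g x)\<^sup>2"
      by (simp add: eq power2_eq_square algebra_simps)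
    then show ?thesis by simp
  qed
  ultimately have "jacobi_poly \<alpha> \<beta> n * g = 0" by (intro jacobi_inner_eq_0_imp_eq_0[OF \<alpha> \<beta>])
  then show False using jacobi_poly_nonzero \<open>g \<noteq> 0\<close> by simp
qed

text \<open>
  With \<open>q\<close> the product of the linear factors of the roots in \<open>(-1, 1)\<close>, the cofactor \<open>g\<close> of \<open>q\<close> has no
  root there because all roots are simple.  So \<open>P q = q\<^sup>2 g\<close> does not change sign, and \<open>q\<close> cannot have
  degree below \<open>n\<close>.
\<close>
theorem card_jacobi_poly_roots: "card {x \<in> {-1<..<1}. poly (jacobi_poly \<alpha> \<beta> n) x = 0} = n"
proof -
  define P where "P = jacobi_poly \<alpha> \<beta> n"
  define S where "S = {x \<in> {-1<..<1}. poly P x = 0}"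
  define q where "q = (\<Prod>z\<in>S. [:-z, 1:])"
  have P0: "P \<noteq> 0" by (simp add: P_def jacobi_poly_nonzero)
  have "S \<subseteq> {x. poly P x = 0}" by (auto simp: S_def)
  then have fin: "finite S" using poly_roots_finite[OF P0] finite_subset by blast
  have "q dvd P" unfolding q_def by (rule linear_factors_dvd[OF fin]) (auto simp: S_def)
  then obtain g where g: "P = q * g" by (rule dvdE)
  have degq: "degree q = card S"
    unfolding q_def by (subst degree_prod_eq_sum_degree) auto
  have "degree q + degree g = n"
    using degree_jacobi_poly[of n] P0 by (auto simp: P_def[symmetric] g degree_mult_eq)
  moreover have "\<not> card S < n"
  proof
    assume lt: "card S < n"
    have g0: "poly g x \<noteq> 0" if x: "x \<in> {-1<..<1}" for x
    proof
      assume gx: "poly g x = 0"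
      then have Px: "poly P x = 0" by (simp add: g)
      then have "poly q x = 0" using x fin by (auto simp: q_def poly_prod S_def)
      then have "poly (pderiv P) x = 0" using gx by (simp add: g pderiv_mult)
      then show False using jacobi_poly_simple_root[of n x] Px by (simp add: P_def)
    qed
    have "(\<forall>x\<in>{-1<..<1}. poly g x > 0) \<or> (\<forall>x\<in>{-1<..<1}. poly g x < 0)"
    proof (rule ccontr)
      assume "\<not> ?thesis"
      then obtain x y where xy: "x \<in> {-1<..<1}" "y \<in> {-1<..<1}" "poly g x \<le> 0" "poly g y \<ge> 0"
        by force
      have "connected (poly g ` {-1<..<1})"
        by (intro connected_continuous_image connected_Ioo continuous_intros)
      from connectedD_interval[OF this, of "poly g x" "poly g y" 0] xy g0 show False by force
    qed
    then obtain c :: real where c: "c \<noteq> 0" "\<And>x. x \<in> {-1<..<1} \<Longrightarrow> c * poly g x \<ge> 0"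
    proof
      assume "\<forall>x\<in>{-1<..<1}. 0 < poly g x" then show thesis by (intro that[of 1]) (simp_all add: less_imp_le)
    next
      assume "\<forall>x\<in>{-1<..<1}. poly g x < 0" then show thesis by (intro that[of "-1"]) (simp_all add: less_imp_le)
    qed
    have "degree (smult c q) < n" using lt degq c by simp
    then have "jacobi_inner \<alpha> \<beta> P (smult c q) = 0" unfolding P_def by (rule jacobi_poly_orthogonal)
    moreover have "poly P x * poly (smult c q) x \<ge> 0" if "x \<in> {-1<..<1}" for x
    proof -
      have "poly P x * poly (smult c q) x = (poly q x)\<^sup>2 * (c * poly g x)"
        by (simp add: g power2_eq_square algebra_simps)
      then show ?thesis using c(2)[OF that] by (metis mult_nonneg_nonneg zero_le_power2)
    qed
    ultimately have "P * smult c q = 0" by (intro jacobi_inner_eq_0_imp_eq_0[OF \<alpha> \<beta>])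
    then show False using P0 c(1) g by auto
  qed
  ultimately show ?thesis using degq by (simp add: S_def P_def)
qed


end

section \<open>The angles of the zeros\<close>

definition jacobi_angles :: "real \<Rightarrow> real \<Rightarrow> nat \<Rightarrow> real set" where
  "jacobi_angles \<alpha> \<beta> n = {\<theta> \<in> {0<..<pi}. poly (jacobi_poly \<alpha> \<beta> n) (cos \<theta>) = 0}"

context
  fixes \<alpha> \<beta> :: real
  assumes \<alpha>: "\<alpha> > -1" and \<beta>: "\<beta> > -1"
begin

lemma finite_jacobi_angles: "finite (jacobi_angles \<alpha> \<beta> n)"
  and card_jacobi_angles: "card (jacobi_angles \<alpha> \<beta> n) = n"
proof -
  let ?S = "{x \<in> {-1<..<1}. poly (jacobi_poly \<alpha> \<beta> n) x = 0}"
  have bij: "bij_betw cos (jacobi_angles \<alpha> \<beta> n) ?S"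
  proof (rule bij_betw_byWitness[where f' = arccos])
    show "cos ` jacobi_angles \<alpha> \<beta> n \<subseteq> ?S"
      using cos_monotone_0_pi[of 0] cos_monotone_0_pi[of _ pi] by (force simp: jacobi_angles_def)
    show "arccos ` ?S \<subseteq> jacobi_angles \<alpha> \<beta> n"
      by (auto simp: jacobi_angles_def arccos_lt_bounded)
  qed (auto simp: jacobi_angles_def arccos_cos)
  show "card (jacobi_angles \<alpha> \<beta> n) = n"
    using bij_betw_same_card[OF bij] card_jacobi_poly_roots[OF \<alpha> \<beta>] by simp
  have "finite ?S"
    using poly_roots_finite[OF jacobi_poly_nonzero[OF \<alpha> \<beta>, of n]] by (rule rev_finite_subset) auto
  then show "finite (jacobi_angles \<alpha> \<beta> n)" using bij_betw_finite[OF bij] by simp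
qed

lemma jacobi_theta_in_angles: "1 \<le> k \<Longrightarrow> k \<le> n \<Longrightarrow> jacobi_theta \<alpha> \<beta> n k \<in> jacobi_angles \<alpha> \<beta> n"
  using nth_mem[of "k - 1" "sorted_list_of_set (jacobi_angles \<alpha> \<beta> n)"]
  by (simp add: finite_jacobi_angles card_jacobi_angles) (simp add: jacobi_theta_def jacobi_angles_def)

lemma jacobi_theta_less: "1 \<le> j \<Longrightarrow> j < k \<Longrightarrow> k \<le> n \<Longrightarrow> jacobi_theta \<alpha> \<beta> n j < jacobi_theta \<alpha> \<beta> n k"
  using sorted_wrt_nth_less[OF strict_sorted_list_of_set[of "jacobi_angles \<alpha> \<beta> n"], of "j - 1" "k - 1"]
  by (simp add: card_jacobi_angles) (simp add: jacobi_theta_def jacobi_angles_def)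

lemma jacobi_theta_less_iff:
  "j \<in> {1..n} \<Longrightarrow> k \<in> {1..n} \<Longrightarrow> jacobi_theta \<alpha> \<beta> n j < jacobi_theta \<alpha> \<beta> n k \<longleftrightarrow> j < k"
  using jacobi_theta_less[of j k n] jacobi_theta_less[of k j n] by (cases j k rule: linorder_cases) auto

lemma jacobi_angles_eq_theta_image: "jacobi_angles \<alpha> \<beta> n = jacobi_theta \<alpha> \<beta> n ` {1..n}"
proof (rule card_subset_eq[OF finite_jacobi_angles, symmetric])
  have "inj_on (jacobi_theta \<alpha> \<beta> n) {1..n}"
    using jacobi_theta_less_iff by (metis inj_onI linorder_neqE_nat order_less_irrefl)
  then show "card (jacobi_theta \<alpha> \<beta> n ` {1..n}) = card (jacobi_angles \<alpha> \<beta> n)"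
    by (simp add: card_image card_jacobi_angles)
qed (auto intro: jacobi_theta_in_angles)

text \<open>
  The position of the \<open>k\<close>-th angle is controlled by counting, so that a comparison argument only has to
  exhibit enough angles on one side.
\<close>
lemma jacobi_theta_le_if_angles_below:
  assumes "T \<subseteq> jacobi_angles \<alpha> \<beta> n" "1 \<le> k" "k \<le> card T" "\<And>t. t \<in> T \<Longrightarrow> t \<le> x"
  shows "jacobi_theta \<alpha> \<beta> n k \<le> x"
proof (rule ccontr)
  assume gt: "\<not> ?thesis"
  have "k \<le> n" using card_mono[OF finite_jacobi_angles assms(1)] assms(3) card_jacobi_angles[of n] by simp
  have "T \<subseteq> jacobi_theta \<alpha> \<beta> n ` {1..<k}"
  proof
    fix t assume t: "t \<in> T"
    then obtain j where j: "j \<in> {1..n}" "t = jacobi_theta \<alpha> \<beta> n j"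
      using assms(1) jacobi_angles_eq_theta_image by blast
    then have "jacobi_theta \<alpha> \<beta> n j < jacobi_theta \<alpha> \<beta> n k" using assms(4)[OF t] gt by simp
    then show "t \<in> jacobi_theta \<alpha> \<beta> n ` {1..<k}"
      using j jacobi_theta_less_iff[of j n k] assms(2) \<open>k \<le> n\<close> by auto
  qed
  from surj_card_le[OF _ this] show False using assms(2,3) by simp
qed

lemma jacobi_theta_ge_if_angles_above:
  assumes "T \<subseteq> jacobi_angles \<alpha> \<beta> n" "k \<in> {1..n}" "n - k < card T" "\<And>t. t \<in> T \<Longrightarrow> x \<le> t"
  shows "x \<le> jacobi_theta \<alpha> \<beta> n k"
proof (rule ccontr)
  assume gt: "\<not> ?thesis"
  have "T \<subseteq> jacobi_theta \<alpha> \<beta> n ` {k<..n}"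
  proof
    fix t assume t: "t \<in> T"
    then obtain j where j: "j \<in> {1..n}" "t = jacobi_theta \<alpha> \<beta> n j"
      using assms(1) jacobi_angles_eq_theta_image by blast
    then have "jacobi_theta \<alpha> \<beta> n k < jacobi_theta \<alpha> \<beta> n j" using assms(4)[OF t] gt by simp
    then show "t \<in> jacobi_theta \<alpha> \<beta> n ` {k<..n}"
      using j jacobi_theta_less_iff[of k n j] assms(2) by auto
  qed
  from surj_card_le[OF _ this] show False using assms(2,3) by simp
qed

end

section \<open>Liouville normal form\<close>

text \<open>
  The functions below use the scaled variable \<open>\<phi> = \<gamma>\<^sub>n \<theta>\<close>.  The amplitude is the factor that removes the
  first order term from the differential equation.
\<close>
definition jacobi_amp :: "real \<Rightarrow> real \<Rightarrow> nat \<Rightarrow> real \<Rightarrow> real" where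
  "jacobi_amp \<alpha> \<beta> n \<phi> =
     sin (\<phi> / (2 * jacobi_gamma \<alpha> \<beta> n)) powr (\<alpha> + 1/2) * cos (\<phi> / (2 * jacobi_gamma \<alpha> \<beta> n)) powr (\<beta> + 1/2)"

text \<open>
  The logarithmic derivative of the amplitude.
\<close>
definition jacobi_amp_log :: "real \<Rightarrow> real \<Rightarrow> nat \<Rightarrow> real \<Rightarrow> real" where
  "jacobi_amp_log \<alpha> \<beta> n \<phi> =
     ((\<alpha> + 1/2) * cot (\<phi> / (2 * jacobi_gamma \<alpha> \<beta> n)) - (\<beta> + 1/2) * tan (\<phi> / (2 * jacobi_gamma \<alpha> \<beta> n)))
       / (2 * jacobi_gamma \<alpha> \<beta> n)"

definition jacobi_osc :: "real \<Rightarrow> real \<Rightarrow> nat \<Rightarrow> real \<Rightarrow> real" where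
  "jacobi_osc \<alpha> \<beta> n \<phi> = poly (jacobi_poly \<alpha> \<beta> n) (cos (\<phi> / jacobi_gamma \<alpha> \<beta> n))"

definition jacobi_osc' :: "real \<Rightarrow> real \<Rightarrow> nat \<Rightarrow> real \<Rightarrow> real" where
  "jacobi_osc' \<alpha> \<beta> n \<phi> = - sin (\<phi> / jacobi_gamma \<alpha> \<beta> n) / jacobi_gamma \<alpha> \<beta> n
     * poly (pderiv (jacobi_poly \<alpha> \<beta> n)) (cos (\<phi> / jacobi_gamma \<alpha> \<beta> n))"

definition jacobi_u :: "real \<Rightarrow> real \<Rightarrow> nat \<Rightarrow> real \<Rightarrow> real" where
  "jacobi_u \<alpha> \<beta> n \<phi> = jacobi_amp \<alpha> \<beta> n \<phi> * jacobi_osc \<alpha> \<beta> n \<phi>"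

definition jacobi_v :: "real \<Rightarrow> real \<Rightarrow> nat \<Rightarrow> real \<Rightarrow> real" where
  "jacobi_v \<alpha> \<beta> n \<phi> = jacobi_amp \<alpha> \<beta> n \<phi> *
     (jacobi_amp_log \<alpha> \<beta> n \<phi> * jacobi_osc \<alpha> \<beta> n \<phi> + jacobi_osc' \<alpha> \<beta> n \<phi>)"

text \<open>
  The function \<open>F\<close> whose monotonicity decides everything; its parameters are \<open>1/4 - \<alpha>\<^sup>2\<close> and \<open>1/4 - \<beta>\<^sup>2\<close>.
\<close>
definition potential :: "real \<Rightarrow> real \<Rightarrow> real \<Rightarrow> real" where
  "potential A B t = A * (t\<^sup>2 / (sin t)\<^sup>2) + B * (t\<^sup>2 / (cos t)\<^sup>2)"

definition jacobi_q :: "real \<Rightarrow> real \<Rightarrow> nat \<Rightarrow> real \<Rightarrow> real" where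
  "jacobi_q \<alpha> \<beta> n \<phi> =
     1 + potential (1/4 - \<alpha>\<^sup>2) (1/4 - \<beta>\<^sup>2) (\<phi> / (2 * jacobi_gamma \<alpha> \<beta> n)) / \<phi>\<^sup>2"

lemma jacobi_gamma_pos: "\<alpha> > -1 \<Longrightarrow> \<beta> > -1 \<Longrightarrow> n \<ge> 1 \<Longrightarrow> jacobi_gamma \<alpha> \<beta> n > 0"
  by (simp add: jacobi_gamma_def field_simps)

text \<open>
  The algebraic core of the Liouville transformation, with \<open>s = sin t\<close>, \<open>c = cos t\<close>, and
  \<open>P0\<close>, \<open>P1\<close>, \<open>P2\<close> the values of the polynomial and its derivatives at \<open>cos (2 t) = c\<^sup>2 - s\<^sup>2\<close>.  The
  terms in \<open>P1\<close> cancel by the choice of the exponents in the amplitude.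
\<close>
lemma liouville_identity:
  fixes s c g \<alpha> \<beta> P0 P1 P2 :: real
  assumes nz: "s \<noteq> 0" "c \<noteq> 0" "g \<noteq> 0" and one: "s\<^sup>2 + c\<^sup>2 = 1"
    and ode: "(1 - (c\<^sup>2 - s\<^sup>2)\<^sup>2) * P2 + (\<beta> - \<alpha> - (\<alpha> + \<beta> + 2) * (c\<^sup>2 - s\<^sup>2)) * P1
        + (g\<^sup>2 - ((\<alpha> + \<beta> + 1) / 2)\<^sup>2) * P0 = 0"
  defines "a \<equiv> \<alpha> + 1/2" and "b \<equiv> \<beta> + 1/2"
  defines "L \<equiv> (a * (c / s) - b * (s / c)) / (2 * g)"
    and "L' \<equiv> - (a / s\<^sup>2 + b / c\<^sup>2) / (4 * g\<^sup>2)"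
    and "p1 \<equiv> - (2 * s * c) / g * P1"
    and "p2 \<equiv> ((2 * s * c)\<^sup>2 * P2 - (c\<^sup>2 - s\<^sup>2) * P1) / g\<^sup>2"
  shows "(L\<^sup>2 + L') * P0 + 2 * L * p1 + p2 =
    - (1 + ((1/4 - \<alpha>\<^sup>2) / s\<^sup>2 + (1/4 - \<beta>\<^sup>2) / c\<^sup>2) / (4 * g\<^sup>2)) * P0"
proof -
  define x y where "x = 1 / s\<^sup>2" and "y = 1 / c\<^sup>2"
  \<comment> \<open>Everything is multiplied by \<open>4 g\<^sup>2\<close> and expressed through \<open>x\<close>, \<open>y\<close> and \<open>s\<^sup>2\<close>.\<close>
  have c2: "c\<^sup>2 = 1 - s\<^sup>2" using one by simp
  have cs: "c\<^sup>2 / s\<^sup>2 = x - 1" "s\<^sup>2 / c\<^sup>2 = y - 1"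
    using nz one by (auto simp: x_def y_def field_simps)
  have "(a * (c / s) - b * (s / c))\<^sup>2 = a\<^sup>2 * (c\<^sup>2 / s\<^sup>2) - 2 * a * b + b\<^sup>2 * (s\<^sup>2 / c\<^sup>2)"
    using nz by (simp add: power2_eq_square field_simps)
  then have sq: "4 * g\<^sup>2 * L\<^sup>2 = a\<^sup>2 * (x - 1) - 2 * a * b + b\<^sup>2 * (y - 1)"
    unfolding cs L_def using nz by (simp add: power_divide power_mult_distrib)
  have L': "4 * g\<^sup>2 * L' = - (a * x + b * y)"
    using nz by (simp add: L'_def x_def y_def)
  have Lp: "4 * g\<^sup>2 * (2 * L * p1) = - 8 * (a * c\<^sup>2 - b * s\<^sup>2) * P1"
    unfolding L_def p1_def using nz by (simp add: power2_eq_square field_simps)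
  have X: "1 - (c\<^sup>2 - s\<^sup>2)\<^sup>2 = (2 * s * c)\<^sup>2"
    using one by algebra
  have p2: "4 * g\<^sup>2 * p2 = 4 * (- (\<beta> - \<alpha> - (\<alpha> + \<beta> + 2) * (c\<^sup>2 - s\<^sup>2)) * P1
       - (g\<^sup>2 - ((\<alpha> + \<beta> + 1) / 2)\<^sup>2) * P0 - (c\<^sup>2 - s\<^sup>2) * P1)"
  proof -
    have "g\<^sup>2 * p2 = (2 * s * c)\<^sup>2 * P2 - (c\<^sup>2 - s\<^sup>2) * P1" using nz by (simp add: p2_def)
    moreover have "(2 * s * c)\<^sup>2 * P2 = - (\<beta> - \<alpha> - (\<alpha> + \<beta> + 2) * (c\<^sup>2 - s\<^sup>2)) * P1
       - (g\<^sup>2 - ((\<alpha> + \<beta> + 1) / 2)\<^sup>2) * P0"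
      using ode unfolding X by linarith
    ultimately show ?thesis by (simp only: mult.assoc)
  qed
  have "4 * g\<^sup>2 * ((L\<^sup>2 + L') * P0 + 2 * L * p1 + p2) =
      (4 * g\<^sup>2 * L\<^sup>2 + 4 * g\<^sup>2 * L') * P0 + 4 * g\<^sup>2 * (2 * L * p1) + 4 * g\<^sup>2 * p2"
    by (simp add: algebra_simps)
  also have "\<dots> = - (4 * g\<^sup>2 + ((1/4 - \<alpha>\<^sup>2) * x + (1/4 - \<beta>\<^sup>2) * y)) * P0"
    unfolding sq L' Lp p2 c2 a_def b_def by (simp add: field_simps power2_eq_square)
  also have "\<dots> = 4 * g\<^sup>2 * (- (1 + ((1/4 - \<alpha>\<^sup>2) * x + (1/4 - \<beta>\<^sup>2) * y) / (4 * g\<^sup>2)) * P0)"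
    using nz by (simp add: field_simps)
  finally show ?thesis using nz by (simp add: x_def y_def)
qed

context
  fixes \<alpha> \<beta> :: real
  assumes \<alpha>: "\<alpha> > -1" and \<beta>: "\<beta> > -1"
begin

lemma half_angle_pos:
  assumes "n \<ge> 1" "\<phi> \<in> {0<..<jacobi_gamma \<alpha> \<beta> n * pi}"
  shows "sin (\<phi> / (2 * jacobi_gamma \<alpha> \<beta> n)) > 0" "cos (\<phi> / (2 * jacobi_gamma \<alpha> \<beta> n)) > 0"
    "\<phi> / (2 * jacobi_gamma \<alpha> \<beta> n) \<in> {0<..<pi/2}"
proof -
  show *: "\<phi> / (2 * jacobi_gamma \<alpha> \<beta> n) \<in> {0<..<pi/2}"
    using assms jacobi_gamma_pos[OF \<alpha> \<beta> assms(1)] by (simp add: field_simps)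
  show "sin (\<phi> / (2 * jacobi_gamma \<alpha> \<beta> n)) > 0" "cos (\<phi> / (2 * jacobi_gamma \<alpha> \<beta> n)) > 0"
    using * by (auto intro!: sin_gt_zero2 cos_gt_zero)
qed

theorem jacobi_u_solves:
  assumes n: "n \<ge> 1"
  shows "solves_on (jacobi_q \<alpha> \<beta> n) (jacobi_u \<alpha> \<beta> n) (jacobi_v \<alpha> \<beta> n) {0<..<jacobi_gamma \<alpha> \<beta> n * pi}"
  unfolding solves_on_def
proof (intro ballI conjI)
  fix \<phi> assume \<phi>: "\<phi> \<in> {0<..<jacobi_gamma \<alpha> \<beta> n * pi}"
  define g where "g = jacobi_gamma \<alpha> \<beta> n"
  define P where "P = jacobi_poly \<alpha> \<beta> n"
  define s c where "s = sin (\<phi> / (2 * g))" and "c = cos (\<phi> / (2 * g))"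
  have g: "g > 0" using jacobi_gamma_pos[OF \<alpha> \<beta> n] by (simp add: g_def)
  have pos: "s > 0" "c > 0" using half_angle_pos[OF n \<phi>] by (auto simp: s_def c_def g_def)
  have one: "s\<^sup>2 + c\<^sup>2 = 1" by (simp add: s_def c_def)
  have double: "cos (\<phi> / g) = c\<^sup>2 - s\<^sup>2" "sin (\<phi> / g) = 2 * s * c"
    using cos_double[of "\<phi> / (2 * g)"] sin_double[of "\<phi> / (2 * g)"] by (simp_all add: s_def c_def)
  define a b where "a = \<alpha> + 1/2" and "b = \<beta> + 1/2"
  define L L' where "L = jacobi_amp_log \<alpha> \<beta> n" and "L' = - (a / s\<^sup>2 + b / c\<^sup>2) / (4 * g\<^sup>2)"
  define S where "S = jacobi_amp \<alpha> \<beta> n"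
  define p0 p1 where "p0 = jacobi_osc \<alpha> \<beta> n" and "p1 = jacobi_osc' \<alpha> \<beta> n"
  define p2 where "p2 = ((2 * s * c)\<^sup>2 * poly (pderiv (pderiv P)) (c\<^sup>2 - s\<^sup>2)
      - (c\<^sup>2 - s\<^sup>2) * poly (pderiv P) (c\<^sup>2 - s\<^sup>2)) / g\<^sup>2"
  have L\<phi>: "L \<phi> = (a * (c / s) - b * (s / c)) / (2 * g)"
    by (simp add: L_def jacobi_amp_log_def a_def b_def s_def c_def g_def cot_def tan_def)
  have lin: "((\<lambda>\<phi>. \<phi> / (2 * g)) has_real_derivative 1 / (2 * g)) (at \<phi>)"
    using g by (auto intro!: derivative_eq_intros)
  have ds: "((\<lambda>\<phi>. sin (\<phi> / (2 * g)) powr a) has_real_derivative s powr a * (a * (c / s) / (2 * g))) (at \<phi>)"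
    using pos g by (auto intro!: derivative_eq_intros simp: s_def c_def powr_diff field_simps)
  have dc: "((\<lambda>\<phi>. cos (\<phi> / (2 * g)) powr b) has_real_derivative - (c powr b * (b * (s / c) / (2 * g)))) (at \<phi>)"
    using pos g by (auto intro!: derivative_eq_intros simp: s_def c_def powr_diff field_simps)
  have dS: "(S has_real_derivative S \<phi> * L \<phi>) (at \<phi>)"
    using DERIV_mult[OF ds dc]
    unfolding S_def L\<phi> jacobi_amp_def[abs_def] g_def[symmetric] a_def[symmetric] b_def[symmetric]
    by (rule DERIV_cong) (unfold s_def[symmetric] c_def[symmetric], simp add: algebra_simps diff_divide_distrib)
  have dcot: "((\<lambda>\<phi>. cot (\<phi> / (2 * g))) has_real_derivative - (1 / s\<^sup>2) / (2 * g)) (at \<phi>)"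
    by (rule DERIV_cong[OF DERIV_chain2[OF DERIV_cot lin]]) (use pos in \<open>auto simp: s_def inverse_eq_divide\<close>)
  have dtan: "((\<lambda>\<phi>. tan (\<phi> / (2 * g))) has_real_derivative (1 / c\<^sup>2) / (2 * g)) (at \<phi>)"
    by (rule DERIV_cong[OF DERIV_chain2[OF DERIV_tan lin]]) (use pos in \<open>auto simp: c_def inverse_eq_divide\<close>)
  have dL: "(L has_real_derivative L') (at \<phi>)"
    unfolding L_def jacobi_amp_log_def[abs_def] g_def[symmetric] a_def[symmetric] b_def[symmetric]
    by (rule DERIV_cong[OF DERIV_cdivide[OF DERIV_diff[OF DERIV_cmult[OF dcot] DERIV_cmult[OF dtan]]]])
      (use g in \<open>simp add: L'_def field_simps power2_eq_square\<close>)
  have lin2: "((\<lambda>\<phi>. \<phi> / g) has_real_derivative 1 / g) (at \<phi>)"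
    using g by (auto intro!: derivative_eq_intros)
  have dcos: "((\<lambda>\<phi>. cos (\<phi> / g)) has_real_derivative - (2 * s * c) / g) (at \<phi>)"
    by (rule DERIV_cong[OF DERIV_chain2[OF DERIV_cos lin2]]) (simp add: double)
  have dsin: "((\<lambda>\<phi>. - sin (\<phi> / g) / g) has_real_derivative - (c\<^sup>2 - s\<^sup>2) / g\<^sup>2) (at \<phi>)"
    by (rule DERIV_cong[OF DERIV_cdivide[OF DERIV_minus[OF DERIV_chain2[OF DERIV_sin lin2]]]])
      (simp add: double power2_eq_square diff_divide_distrib)
  have dp0: "(p0 has_real_derivative p1 \<phi>) (at \<phi>)"
    unfolding p0_def p1_def jacobi_osc_def[abs_def] jacobi_osc'_def g_def[symmetric] P_def[symmetric]
    by (rule DERIV_cong[OF DERIV_chain2[OF poly_DERIV dcos]]) (simp add: double)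
  have dp1: "(p1 has_real_derivative p2) (at \<phi>)"
    unfolding p1_def jacobi_osc'_def[abs_def] g_def[symmetric] P_def[symmetric]
    by (rule DERIV_cong[OF DERIV_mult[OF dsin DERIV_chain2[OF poly_DERIV dcos]]])
      (use g in \<open>simp add: double p2_def field_simps power2_eq_square\<close>)
  have u: "jacobi_u \<alpha> \<beta> n = (\<lambda>\<phi>. S \<phi> * p0 \<phi>)" and v: "jacobi_v \<alpha> \<beta> n = (\<lambda>\<phi>. S \<phi> * (L \<phi> * p0 \<phi> + p1 \<phi>))"
    by (simp_all add: jacobi_u_def[abs_def] jacobi_v_def[abs_def] S_def L_def p0_def p1_def)
  show "(jacobi_u \<alpha> \<beta> n has_real_derivative jacobi_v \<alpha> \<beta> n \<phi>) (at \<phi>)"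
    unfolding u v by (rule DERIV_cong[OF DERIV_mult[OF dS dp0]]) (simp add: algebra_simps)
  have "(jacobi_v \<alpha> \<beta> n has_real_derivative S \<phi> * (((L \<phi>)\<^sup>2 + L') * p0 \<phi> + 2 * L \<phi> * p1 \<phi> + p2)) (at \<phi>)"
    unfolding v by (rule DERIV_cong[OF DERIV_mult[OF dS DERIV_add[OF DERIV_mult[OF dL dp0] dp1]]])
      (simp add: algebra_simps power2_eq_square)
  moreover have "((L \<phi>)\<^sup>2 + L') * p0 \<phi> + 2 * L \<phi> * p1 \<phi> + p2 = - jacobi_q \<alpha> \<beta> n \<phi> * p0 \<phi>"
  proof -
    \<comment> \<open>The shift in \<open>\<gamma>\<^sub>n\<close> completes the square in the eigenvalue.\<close>
    have lam: "real n * (real n + \<alpha> + \<beta> + 1) = g\<^sup>2 - ((\<alpha> + \<beta> + 1) / 2)\<^sup>2"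
      by (simp add: g_def jacobi_gamma_def power2_eq_square field_simps)
    have p1: "p1 \<phi> = - (2 * s * c) / g * poly (pderiv P) (c\<^sup>2 - s\<^sup>2)"
      by (simp add: p1_def jacobi_osc'_def g_def[symmetric] P_def[symmetric] double)
    have p0: "p0 \<phi> = poly P (c\<^sup>2 - s\<^sup>2)"
      by (simp add: p0_def jacobi_osc_def g_def[symmetric] P_def[symmetric] double)
    have "jacobi_q \<alpha> \<beta> n \<phi> = 1 + ((1/4 - \<alpha>\<^sup>2) / s\<^sup>2 + (1/4 - \<beta>\<^sup>2) / c\<^sup>2) / (4 * g\<^sup>2)"
      unfolding jacobi_q_def potential_def g_def[symmetric] s_def[symmetric] c_def[symmetric]
      using \<phi> pos g by (simp add: power_divide field_simps)
    then show ?thesis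
      unfolding L\<phi> L'_def p1 p0 p2_def a_def b_def
      using liouville_identity[OF _ _ _ one, of g "poly (pderiv (pderiv P)) (c\<^sup>2 - s\<^sup>2)" \<beta> \<alpha>
          "poly (pderiv P) (c\<^sup>2 - s\<^sup>2)" "poly P (c\<^sup>2 - s\<^sup>2)"]
        jacobi_poly_ode[OF \<alpha> \<beta>, of "c\<^sup>2 - s\<^sup>2" n] pos g
      by (simp only: lam P_def[symmetric] a_def b_def)
  qed
  ultimately show "(jacobi_v \<alpha> \<beta> n has_real_derivative - jacobi_q \<alpha> \<beta> n \<phi> * jacobi_u \<alpha> \<beta> n \<phi>) (at \<phi>)"
    by (simp add: u mult.left_commute)
qed

lemma jacobi_amp_pos:
  assumes "n \<ge> 1" "\<phi> \<in> {0<..<jacobi_gamma \<alpha> \<beta> n * pi}"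
  shows "jacobi_amp \<alpha> \<beta> n \<phi> > 0"
  using half_angle_pos[OF assms] by (simp add: jacobi_amp_def)

lemma jacobi_u_zero_iff:
  assumes "n \<ge> 1" "\<phi> \<in> {0<..<jacobi_gamma \<alpha> \<beta> n * pi}"
  shows "jacobi_u \<alpha> \<beta> n \<phi> = 0 \<longleftrightarrow> \<phi> / jacobi_gamma \<alpha> \<beta> n \<in> jacobi_angles \<alpha> \<beta> n"
  using jacobi_amp_pos[OF assms] assms jacobi_gamma_pos[OF \<alpha> \<beta> assms(1)]
  by (auto simp: jacobi_u_def jacobi_angles_def jacobi_osc_def field_simps)

text \<open>
  At a zero only the derivative of the polynomial factor survives, and the polynomial has simple roots.
\<close>
lemma jacobi_u_simple_zero:
  assumes "n \<ge> 1" "\<phi> \<in> {0<..<jacobi_gamma \<alpha> \<beta> n * pi}" "jacobi_u \<alpha> \<beta> n \<phi> = 0"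
  shows "jacobi_v \<alpha> \<beta> n \<phi> \<noteq> 0"
proof -
  have g: "jacobi_gamma \<alpha> \<beta> n > 0" by (rule jacobi_gamma_pos[OF \<alpha> \<beta> assms(1)])
  have zero: "jacobi_osc \<alpha> \<beta> n \<phi> = 0"
    using assms(3) jacobi_amp_pos[OF assms(1,2)] by (simp add: jacobi_u_def)
  have "sin (\<phi> / jacobi_gamma \<alpha> \<beta> n) > 0"
    using assms(2) g by (intro sin_gt_zero) (auto simp: field_simps)
  then have "jacobi_osc' \<alpha> \<beta> n \<phi> \<noteq> 0"
    using zero g jacobi_poly_simple_root[OF \<alpha> \<beta>] by (auto simp: jacobi_osc_def jacobi_osc'_def)
  then show ?thesis
    using jacobi_amp_pos[OF assms(1,2)] by (simp add: jacobi_v_def zero)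
qed

text \<open>
  The Wronskian is \<open>\<phi> S\<^sub>m S\<^sub>n\<close> times a bounded factor, where \<open>S\<^sub>m\<close> and \<open>S\<^sub>n\<close> are the amplitudes: their
  logarithmic derivatives have the same pole \<open>(\<alpha> + 1/2) / \<phi>\<close>, so their difference is of order \<open>\<phi>\<close>, as are
  the derivatives of the polynomial factors.  And \<open>\<phi> S\<^sub>m S\<^sub>n\<close> is of order \<open>\<phi>^(2 \<alpha> + 2)\<close>.
\<close>
lemma jacobi_wronskian_at_0:
  assumes m: "m \<ge> 1" and n: "n \<ge> 1"
  shows "((\<lambda>\<phi>. jacobi_u \<alpha> \<beta> m \<phi> * jacobi_v \<alpha> \<beta> n \<phi> - jacobi_v \<alpha> \<beta> m \<phi> * jacobi_u \<alpha> \<beta> n \<phi>) \<longlongrightarrow> 0) (at_right 0)"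
proof -
  define d where "d = (\<lambda>n. 1 / (2 * jacobi_gamma \<alpha> \<beta> n))"
  have d: "d m > 0" "d n > 0" using jacobi_gamma_pos[OF \<alpha> \<beta>] m n by (auto simp: d_def)
  define a b where "a = \<alpha> + 1/2" and "b = \<beta> + 1/2"
  have dphi: "\<phi> / (2 * jacobi_gamma \<alpha> \<beta> k) = d k * \<phi>" "\<phi> / jacobi_gamma \<alpha> \<beta> k = 2 * d k * \<phi>" for k \<phi>
    by (simp_all add: d_def)
  have amp: "((\<lambda>\<phi>. (sin (c * \<phi>) / \<phi>) powr a * cos (c * \<phi>) powr b) \<longlongrightarrow> c powr a * 1 powr b) (at_right 0)"
    if "c > 0" for c :: real
  proof (intro tendsto_mult tendsto_powr tendsto_const)
    show "((\<lambda>\<phi>. sin (c * \<phi>) / \<phi>) \<longlongrightarrow> c) (at_right 0)" "((\<lambda>\<phi>. cos (c * \<phi>)) \<longlongrightarrow> 1) (at_right 0)"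
      by real_asymp+
  qed (use that in auto)
  have "((\<lambda>\<phi>::real. \<phi> powr (2 * a + 1)) \<longlongrightarrow> 0) (at_right 0)"
  proof -
    \<comment> \<open>This exponent is \<open>2 \<alpha> + 2\<close>.\<close>
    have "2 * a + 1 > 0" using \<alpha> by (simp add: a_def)
    then show ?thesis by real_asymp
  qed
  from tendsto_mult[OF this tendsto_mult[OF amp[OF d(1)] amp[OF d(2)]]]
  have "((\<lambda>\<phi>. \<phi> powr (2 * a + 1) * ((sin (d m * \<phi>) / \<phi>) powr a * cos (d m * \<phi>) powr b *
      ((sin (d n * \<phi>) / \<phi>) powr a * cos (d n * \<phi>) powr b))) \<longlongrightarrow> 0) (at_right 0)" by simp
  moreover have "\<forall>\<^sub>F \<phi> in at_right 0. \<phi> powr (2 * a + 1) * ((sin (d m * \<phi>) / \<phi>) powr a * cos (d m * \<phi>) powr b *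
      ((sin (d n * \<phi>) / \<phi>) powr a * cos (d n * \<phi>) powr b)) = \<phi> * jacobi_amp \<alpha> \<beta> m \<phi> * jacobi_amp \<alpha> \<beta> n \<phi>"
  proof -
    have "0 < pi / (2 * max (d m) (d n))" using d by simp
    from eventually_at_right_real[OF this] show ?thesis
    proof eventually_elim
      case (elim \<phi>)
      then have "\<phi> > 0" "max (d m) (d n) * \<phi> < pi / 2" using d by (auto simp: field_simps)
      moreover have "d m * \<phi> \<le> max (d m) (d n) * \<phi>" "d n * \<phi> \<le> max (d m) (d n) * \<phi>"
        using elim by (auto intro!: mult_right_mono)
      ultimately have "\<phi> > 0" "d m * \<phi> < pi / 2" "d n * \<phi> < pi / 2" by linarith+
      then have "\<phi> > 0" "sin (d m * \<phi>) > 0" "sin (d n * \<phi>) > 0"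
        using d by (auto intro!: sin_gt_zero2)
      then have powr: "\<phi> powr (2 * a + 1) = \<phi> * (\<phi> powr a * \<phi> powr a)"
        "(sin (d m * \<phi>) / \<phi>) powr a = sin (d m * \<phi>) powr a / \<phi> powr a"
        "(sin (d n * \<phi>) / \<phi>) powr a = sin (d n * \<phi>) powr a / \<phi> powr a" "\<phi> powr a \<noteq> 0"
        using powr_add[of \<phi> "a + a" 1] powr_add[of \<phi> a a] by (simp_all add: powr_divide)
      show ?case
        unfolding jacobi_amp_def dphi a_def[symmetric] b_def[symmetric] powr(1-3)
        using powr(4) by simp
    qed
  qed
  ultimately have small: "((\<lambda>\<phi>. \<phi> * jacobi_amp \<alpha> \<beta> m \<phi> * jacobi_amp \<alpha> \<beta> n \<phi>) \<longlongrightarrow> 0) (at_right 0)"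
    by (rule Lim_transform_eventually)
  have cot_tan: "((\<lambda>\<phi>. (c * cot (c * \<phi>) - 1 / \<phi>) / \<phi>) \<longlongrightarrow> - c\<^sup>2 / 3) (at_right 0)"
    "((\<lambda>\<phi>. c * tan (c * \<phi>) / \<phi>) \<longlongrightarrow> c\<^sup>2) (at_right 0)" if "c > 0" for c :: real
    unfolding cot_def tan_def using that by (real_asymp simp: power2_eq_square field_simps)+
  have lim_log: "((\<lambda>\<phi>. a * (((d n * cot (d n * \<phi>) - 1 / \<phi>) / \<phi>) - ((d m * cot (d m * \<phi>) - 1 / \<phi>) / \<phi>))
      - b * (d n * tan (d n * \<phi>) / \<phi> - d m * tan (d m * \<phi>) / \<phi>))
      \<longlongrightarrow> a * (- (d n)\<^sup>2 / 3 - - (d m)\<^sup>2 / 3) - b * ((d n)\<^sup>2 - (d m)\<^sup>2)) (at_right 0)"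
    by (intro tendsto_intros cot_tan d)
  have "\<forall>\<^sub>F \<phi> in at_right 0. a * (((d n * cot (d n * \<phi>) - 1 / \<phi>) / \<phi>) - ((d m * cot (d m * \<phi>) - 1 / \<phi>) / \<phi>))
      - b * (d n * tan (d n * \<phi>) / \<phi> - d m * tan (d m * \<phi>) / \<phi>) =
      (jacobi_amp_log \<alpha> \<beta> n \<phi> - jacobi_amp_log \<alpha> \<beta> m \<phi>) / \<phi>"
    using eventually_at_right_less[of 0]
  proof eventually_elim
    case (elim \<phi>)
    have "jacobi_amp_log \<alpha> \<beta> k \<phi> = a * (d k * cot (d k * \<phi>)) - b * (d k * tan (d k * \<phi>))" for k
      by (simp add: jacobi_amp_log_def dphi a_def[symmetric] b_def[symmetric] algebra_simps)
    note log = this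
    have "a * ((x - 1 / \<phi>) / \<phi> - (y - 1 / \<phi>) / \<phi>) - b * (z / \<phi> - w / \<phi>) = (a * x - b * z - (a * y - b * w)) / \<phi>"
      for x y z w using elim by (simp add: field_simps)
    then show ?case unfolding log .
  qed
  note L = Lim_transform_eventually[OF lim_log this]
  have cos1: "((\<lambda>\<phi>. cos (2 * d k * \<phi>)) \<longlongrightarrow> 1) (at_right 0)" for k by real_asymp
  have p0: "(jacobi_osc \<alpha> \<beta> k \<longlongrightarrow> poly (jacobi_poly \<alpha> \<beta> k) 1) (at_right 0)" for k
    unfolding jacobi_osc_def[abs_def] dphi by (intro tendsto_poly cos1)
  have p1: "((\<lambda>\<phi>. jacobi_osc' \<alpha> \<beta> k \<phi> / \<phi>) \<longlongrightarrow> - (2 * d k) * (2 * d k) * poly (pderiv (jacobi_poly \<alpha> \<beta> k)) 1) (at_right 0)" for k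
  proof -
    have "((\<lambda>\<phi>. sin (2 * d k * \<phi>) / \<phi>) \<longlongrightarrow> 2 * d k) (at_right 0)" by real_asymp
    then have "((\<lambda>\<phi>. - (2 * d k) * (sin (2 * d k * \<phi>) / \<phi>) * poly (pderiv (jacobi_poly \<alpha> \<beta> k)) (cos (2 * d k * \<phi>)))
      \<longlongrightarrow> - (2 * d k) * (2 * d k) * poly (pderiv (jacobi_poly \<alpha> \<beta> k)) 1) (at_right 0)"
      by (intro tendsto_intros tendsto_poly cos1)
    moreover have "jacobi_osc' \<alpha> \<beta> k \<phi> / \<phi> =
        - (2 * d k) * (sin (2 * d k * \<phi>) / \<phi>) * poly (pderiv (jacobi_poly \<alpha> \<beta> k)) (cos (2 * d k * \<phi>))" for \<phi>
      by (simp add: jacobi_osc'_def dphi)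
    ultimately show ?thesis by simp
  qed
  \<comment> \<open>The Wronskian after division by \<open>\<phi>\<close> and by both amplitudes.\<close>
  let ?M = "\<lambda>\<phi>. jacobi_osc \<alpha> \<beta> m \<phi> * jacobi_osc \<alpha> \<beta> n \<phi> * ((jacobi_amp_log \<alpha> \<beta> n \<phi> - jacobi_amp_log \<alpha> \<beta> m \<phi>) / \<phi>)
      + jacobi_osc \<alpha> \<beta> m \<phi> * (jacobi_osc' \<alpha> \<beta> n \<phi> / \<phi>) - jacobi_osc' \<alpha> \<beta> m \<phi> / \<phi> * jacobi_osc \<alpha> \<beta> n \<phi>"
  have "((\<lambda>\<phi>. \<phi> * jacobi_amp \<alpha> \<beta> m \<phi> * jacobi_amp \<alpha> \<beta> n \<phi> * ?M \<phi>) \<longlongrightarrow> 0) (at_right 0)"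
    using tendsto_mult[OF small tendsto_diff[OF tendsto_add[OF tendsto_mult[OF tendsto_mult[OF p0 p0] L]
          tendsto_mult[OF p0 p1]] tendsto_mult[OF p1 p0]], of m n m n m n] by (simp only: mult_zero_left)
  moreover have "\<forall>\<^sub>F \<phi> in at_right 0. \<phi> * jacobi_amp \<alpha> \<beta> m \<phi> * jacobi_amp \<alpha> \<beta> n \<phi> * ?M \<phi> =
      jacobi_u \<alpha> \<beta> m \<phi> * jacobi_v \<alpha> \<beta> n \<phi> - jacobi_v \<alpha> \<beta> m \<phi> * jacobi_u \<alpha> \<beta> n \<phi>"
    using eventually_at_right_less[of 0]
  proof eventually_elim
    case (elim \<phi>)
    have "\<phi> * A * B * (p * q * ((M - L) / \<phi>) + p * (q' / \<phi>) - p' / \<phi> * q) =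
        A * p * (B * (M * q + q')) - A * (L * p + p') * (B * q)" for A B p q p' q' L M :: real
      using elim by (simp add: field_simps)
    then show ?case unfolding jacobi_u_def jacobi_v_def .
  qed
  ultimately show ?thesis by (rule Lim_transform_eventually)
qed

end

section \<open>Monotonicity of the potential\<close>

lemma potential_uminus: "potential (- A) (- B) t = - potential A B t"
  by (simp add: potential_def algebra_simps)

text \<open>
  The derivative of the potential divided by \<open>2 t\<close>, which keeps a finite limit at \<open>0\<close>.
\<close>
definition potential_slope :: "real \<Rightarrow> real \<Rightarrow> real \<Rightarrow> real" where
  "potential_slope A B t =
     A * ((sin t - t * cos t) / sin t ^ 3) + B * ((cos t + t * sin t) / cos t ^ 3)"

lemma potential_deriv:
  assumes "t \<in> {0<..<pi/2}"
  shows "(potential A B has_real_derivative 2 * t * potential_slope A B t) (at t)"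
proof -
  have nz: "sin t \<noteq> 0" "cos t \<noteq> 0" using assms sin_gt_zero2[of t] cos_gt_zero[of t] by auto
  have 1: "((\<lambda>t. t\<^sup>2 / (sin t)\<^sup>2) has_real_derivative 2 * t * ((sin t - t * cos t) / sin t ^ 3)) (at t)"
    using nz by (auto intro!: derivative_eq_intros simp: field_simps power2_eq_square power3_eq_cube)
  have 2: "((\<lambda>t. t\<^sup>2 / (cos t)\<^sup>2) has_real_derivative 2 * t * ((cos t + t * sin t) / cos t ^ 3)) (at t)"
    using nz by (auto intro!: derivative_eq_intros simp: field_simps power2_eq_square power3_eq_cube)
  show ?thesis
    unfolding potential_def[abs_def]
    by (rule DERIV_cong[OF DERIV_add[OF DERIV_cmult[OF 1] DERIV_cmult[OF 2]]])
      (simp add: potential_slope_def algebra_simps)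
qed

text \<open>
  In both cases the difference of the two sides vanishes at \<open>0\<close> and has a nonnegative derivative; for the
  second one the derivative is \<open>4 tan\<^sup>4 x + 4 x tan\<^sup>3 x (1 + tan\<^sup>2 x)\<close>.
\<close>
lemma tan_bounds:
  assumes t: "t \<in> {0<..<pi/2}"
  shows "t \<le> tan t" "3 * (tan t - t) \<le> tan t ^ 3 * (1 + t * tan t)"
proof -
  have c: "cos x > 0" "cos x \<noteq> 0" if "0 \<le> x" "x \<le> t" for x
    using that t cos_gt_zero_pi[of x] by auto
  have dtan: "(tan has_real_derivative 1 + (tan x)\<^sup>2) (at x)" if "0 \<le> x" "x \<le> t" for x
    using DERIV_tan[OF c(2)[OF that]] tan_sec[OF c(2)[OF that]] by (simp add: power_inverse)
  have tan0: "tan x \<ge> 0" if "0 \<le> x" "x \<le> t" for x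
    using that t tan_gt_zero[of x] by (cases "x = 0") auto
  have "tan 0 - 0 \<le> tan t - t"
  proof (rule DERIV_nonneg_imp_nondecreasing[where f = "\<lambda>x. tan x - x"])
    fix x assume x: "0 \<le> x" "x \<le> t"
    have "((\<lambda>x. tan x - x) has_real_derivative (tan x)\<^sup>2) (at x)"
      by (rule DERIV_cong[OF DERIV_diff[OF dtan[OF x] DERIV_ident]]) simp
    then show "\<exists>y. ((\<lambda>x. tan x - x) has_real_derivative y) (at x) \<and> 0 \<le> y" by force
  qed (use t in auto)
  then show "t \<le> tan t" by simp
  let ?h = "\<lambda>x. tan x ^ 3 * (1 + x * tan x) - 3 * (tan x - x)"
  have "?h 0 \<le> ?h t"
  proof (rule DERIV_nonneg_imp_nondecreasing[where f = ?h])
    fix x assume x: "0 \<le> x" "x \<le> t"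
    have "(?h has_real_derivative 4 * tan x ^ 4 + 4 * x * tan x ^ 3 * (1 + (tan x)\<^sup>2)) (at x)"
      by (rule derivative_eq_intros dtan[OF x] refl)+
        (simp add: algebra_simps power2_eq_square power3_eq_cube power4_eq_xxxx)
    moreover have "4 * tan x ^ 4 + 4 * x * tan x ^ 3 * (1 + (tan x)\<^sup>2) \<ge> 0"
      using tan0[OF x] x by (intro add_nonneg_nonneg mult_nonneg_nonneg) auto
    ultimately show "\<exists>y. (?h has_real_derivative y) (at x) \<and> 0 \<le> y" by blast
  qed (use t in auto)
  then show "3 * (tan t - t) \<le> tan t ^ 3 * (1 + t * tan t)" by simp
qed

text \<open>
  Let \<open>X\<close> and \<open>Y\<close> be the slopes of the two summands.  Then \<open>A X + B Y = (A + 3 B) X + B (Y - 3 X)\<close>, and the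
  bounds for the tangent give \<open>X \<ge> 0\<close> and \<open>Y \<ge> 3 X\<close>.
\<close>
lemma potential_slope_nonneg:
  assumes B: "B \<ge> 0" and AB: "A + 3 * B \<ge> 0" and t: "t \<in> {0<..<pi/2}"
  shows "potential_slope A B t \<ge> 0"
proof -
  define T c where "T = tan t" and "c = cos t"
  have pos: "c > 0" "T > 0" using t by (auto simp: T_def c_def cos_gt_zero tan_gt_zero)
  have s: "sin t = T * c" using pos by (simp add: T_def c_def tan_def)
  define X Y where "X = (sin t - t * cos t) / sin t ^ 3" and "Y = (cos t + t * sin t) / cos t ^ 3"
  have X: "X = (T - t) / (T ^ 3 * c\<^sup>2)" and Y: "Y = (1 + t * T) / c\<^sup>2"
    unfolding X_def Y_def s c_def[symmetric] using pos
    by (simp_all add: field_simps power2_eq_square power3_eq_cube)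
  have "X \<ge> 0" using tan_bounds(1)[OF t] pos by (simp add: X T_def)
  moreover have "Y - 3 * X = (T ^ 3 * (1 + t * T) - 3 * (T - t)) / (T ^ 3 * c\<^sup>2)"
    unfolding X Y using pos by (simp add: field_simps)
  then have "Y - 3 * X \<ge> 0" using tan_bounds(2)[OF t] pos by (simp add: T_def)
  ultimately have "(A + 3 * B) * X + B * (Y - 3 * X) \<ge> 0" using B AB by simp
  also have "(A + 3 * B) * X + B * (Y - 3 * X) = potential_slope A B t"
    unfolding potential_slope_def X_def[symmetric] Y_def[symmetric] by (simp add: algebra_simps)
  finally show ?thesis .
qed

lemma potential_mono:
  assumes "B \<ge> 0" "A + 3 * B \<ge> 0" "0 < s" "s \<le> t" "t < pi/2"
  shows "potential A B s \<le> potential A B t"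
proof (rule DERIV_nonneg_imp_nondecreasing[OF assms(4)])
  fix x assume "s \<le> x" "x \<le> t"
  then have x: "x \<in> {0<..<pi/2}" using assms by auto
  then have "2 * x * potential_slope A B x \<ge> 0" using potential_slope_nonneg[OF assms(1,2) x] by simp
  then show "\<exists>y. (potential A B has_real_derivative y) (at x) \<and> 0 \<le> y" using potential_deriv[OF x] by blast
qed

lemma potential_antimono:
  assumes "B \<le> 0" "A + 3 * B \<le> 0" "0 < s" "s \<le> t" "t < pi/2"
  shows "potential A B t \<le> potential A B s"
  using potential_mono[of "- B" "- A" s t] assms by (simp add: potential_uminus)

text \<open>
  The slope tends to \<open>A / 3 + B\<close>.
\<close>
lemma potential_strict_mono_near_0:
  assumes "A + 3 * B > 0"
  obtains \<delta> where "0 < \<delta>" "\<delta> < pi/2" "\<And>s t. 0 < s \<Longrightarrow> s < t \<Longrightarrow> t < \<delta> \<Longrightarrow> potential A B s < potential A B t"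
proof -
  have "((\<lambda>t::real. (sin t - t * cos t) / sin t ^ 3) \<longlongrightarrow> 1/3) (at_right 0)"
    "((\<lambda>t::real. (cos t + t * sin t) / cos t ^ 3) \<longlongrightarrow> 1) (at_right 0)"
    by real_asymp+
  from tendsto_add[OF tendsto_mult_left[OF this(1), of A] tendsto_mult_left[OF this(2), of B]]
  have "(potential_slope A B \<longlongrightarrow> A * (1/3) + B * 1) (at_right 0)"
    unfolding potential_slope_def[abs_def] .
  then have "\<forall>\<^sub>F t in at_right 0. potential_slope A B t > 0"
    by (rule order_tendstoD(1)) (use assms in simp)
  then obtain d where d: "d > 0" "\<And>t. 0 < t \<Longrightarrow> t < d \<Longrightarrow> potential_slope A B t > 0"
    by (auto simp: eventually_at_right_field)
  show thesis
  proof (rule that[of "min d 1"])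
    fix s t assume st: "0 < s" "s < t" "t < min d 1"
    show "potential A B s < potential A B t"
    proof (rule DERIV_pos_imp_increasing[OF st(2)])
      fix x assume x: "s \<le> x" "x \<le> t"
      then have "x \<in> {0<..<pi/2}" "2 * x * potential_slope A B x > 0"
        using st d(2)[of x] pi_gt3 by auto
      then show "\<exists>y. (potential A B has_real_derivative y) (at x) \<and> 0 < y" using potential_deriv by blast
    qed
  qed (use d pi_gt3 in auto)
qed

lemma potential_near_0:
  assumes "\<epsilon> > 0"
  obtains \<delta> where "0 < \<delta>" "\<delta> < pi/2" "\<And>t. 0 < t \<Longrightarrow> t < \<delta> \<Longrightarrow> \<bar>potential A B t - A\<bar> < \<epsilon>"
proof -
  have "((\<lambda>t::real. t\<^sup>2 / (sin t)\<^sup>2) \<longlongrightarrow> 1) (at_right 0)" "((\<lambda>t::real. t\<^sup>2 / (cos t)\<^sup>2) \<longlongrightarrow> 0) (at_right 0)"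
    by real_asymp+
  from tendsto_add[OF tendsto_mult_left[OF this(1), of A] tendsto_mult_left[OF this(2), of B]]
  have "(potential A B \<longlongrightarrow> A) (at_right 0)"
    unfolding potential_def[abs_def] by simp
  from tendstoD[OF this assms] have "\<forall>\<^sub>F t in at_right 0. \<bar>potential A B t - A\<bar> < \<epsilon>"
    by (simp add: dist_real_def)
  then obtain d where "d > 0" "\<And>t. 0 < t \<Longrightarrow> t < d \<Longrightarrow> \<bar>potential A B t - A\<bar> < \<epsilon>"
    by (auto simp: eventually_at_right_field)
  then show thesis using that[of "min d 1"] pi_gt3 by auto
qed

section \<open>Comparison with sine functions\<close>

text \<open>
  Comparison with \<open>sin (w (x - a))\<close>, whose next zero after \<open>a\<close> is \<open>a + \<pi> / w\<close>.
\<close>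
lemma zero_within_half_period:
  assumes w: "w > 0" and S: "solves_on q u v {a..a + pi / w}"
    and q: "\<And>x. x \<in> {a<..<a + pi / w} \<Longrightarrow> w\<^sup>2 \<le> q x"
  shows "\<exists>x\<in>{a<..a + pi / w}. u x = 0"
proof (rule sturm_comparison(1)[where ?q1.0 = "\<lambda>_. w\<^sup>2" and ?q2.0 = q and ?v2.0 = v
      and ?u1.0 = "\<lambda>x. sin (w * (x - a))" and ?v1.0 = "\<lambda>x. w * cos (w * (x - a))"])
  have "0 < pi / w" using w by simp
  then show "a < a + pi / w" by simp
  show "solves_on q u v {a<..a + pi / w}" by (rule solves_on_subset[OF S]) auto
  have "solves_on q u v {a}" by (rule solves_on_subset[OF S]) (use w in auto)
  then show "((\<lambda>x. sin (w * (x - a)) * v x - w * cos (w * (x - a)) * u x) \<longlongrightarrow> 0) (at_right a) \<or>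
    solves_on (\<lambda>_. w\<^sup>2) (\<lambda>x. sin (w * (x - a))) (\<lambda>x. w * cos (w * (x - a))) {a} \<and>
    solves_on q u v {a} \<and> sin (w * (a - a)) = 0"
    using solves_on_sin by simp
  show "sin (w * (x - a)) \<noteq> 0" if "x \<in> {a<..<a + pi / w}" for x
    using that w sin_gt_zero[of "w * (x - a)"] by (auto simp: field_simps)
qed (use w q solves_on_sin in auto)

lemma zero_gap_at_least_half_period:
  assumes ab: "a < b" and w: "w > 0" and S: "solves_on q u v {a..b}"
    and zero: "u a = 0" "u b = 0" "v b \<noteq> 0" and nz: "\<And>x. x \<in> {a<..<b} \<Longrightarrow> u x \<noteq> 0"
    and q: "\<And>x. x \<in> {a<..<b} \<Longrightarrow> q x \<le> w\<^sup>2"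
  shows "pi / w \<le> b - a"
proof -
  have "\<exists>x\<in>{a<..b}. sin (w * (x - a)) = 0"
  proof (rule sturm_comparison(1)[where ?q1.0 = q and ?q2.0 = "\<lambda>_. w\<^sup>2" and ?v1.0 = v
        and ?u1.0 = u and ?v2.0 = "\<lambda>x. w * cos (w * (x - a))"])
    show "solves_on q u v {a<..b}" by (rule solves_on_subset[OF S]) auto
    have "solves_on q u v {a}" by (rule solves_on_subset[OF S]) (use ab in auto)
    then show "((\<lambda>x. u x * (w * cos (w * (x - a))) - v x * sin (w * (x - a))) \<longlongrightarrow> 0) (at_right a) \<or>
      solves_on q u v {a} \<and> solves_on (\<lambda>_. w\<^sup>2) (\<lambda>x. sin (w * (x - a))) (\<lambda>x. w * cos (w * (x - a))) {a} \<and> u a = 0"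
      using solves_on_sin zero by simp
  qed (use ab zero nz q solves_on_sin in auto)
  then obtain x where x: "a < x" "x \<le> b" "sin (w * (x - a)) = 0" by auto
  have "\<not> w * (x - a) < pi" using sin_gt_zero[of "w * (x - a)"] x w by auto
  then have "pi / w \<le> x - a" using w by (simp add: field_simps)
  then show ?thesis using x by simp
qed

text \<open>
  A potential bounded below by \<open>- C\<close> leaves at least the frequency \<open>1/2\<close> beyond distance \<open>2 C\<close>; the hypothesis
  \<open>C \<ge> 1\<close> turns \<open>s\<^sup>2 \<ge> 4 C\<^sup>2\<close> into \<open>s\<^sup>2 \<ge> 4 C\<close>.
\<close>
lemma frequency_bound:
  fixes C s p :: real
  assumes C: "C \<ge> 1" and s: "s \<ge> 2 * C" and p: "p \<ge> - C"
  shows "(1/2)\<^sup>2 \<le> 1 + p / s\<^sup>2"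
proof -
  have "(2 * C)\<^sup>2 \<le> s\<^sup>2" using C s by (intro power_mono) auto
  moreover have "C * 1 \<le> C * C" using C by (intro mult_left_mono) auto
  ultimately have "4 * C \<le> s\<^sup>2" by (simp add: power2_eq_square)
  then have "s\<^sup>2 > 0" "- p * 4 \<le> s\<^sup>2" using C p by linarith+
  then have "- p / s\<^sup>2 \<le> 1 / 4" by (simp add: field_simps)
  then show ?thesis by (simp add: power2_eq_square)
qed

section \<open>Scaled zeros of consecutive degrees\<close>

text \<open>
  A real sequence that eventually gains a fixed amount at every step exceeds every bound.
\<close>
lemma no_bounded_drift:
  fixes s :: "nat \<Rightarrow> real"
  assumes "c > 0" "\<forall>\<^sub>F n in sequentially. s n + c \<le> s (n + 1)" "\<forall>\<^sub>F n in sequentially. s n \<le> K"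
  shows False
proof -
  obtain N where N: "\<And>n. n \<ge> N \<Longrightarrow> s n + c \<le> s (n + 1)" "\<And>n. n \<ge> N \<Longrightarrow> s n \<le> K"
    using eventually_conj[OF assms(2,3)] by (auto simp: eventually_sequentially)
  have "s N + real j * c \<le> s (N + j)" for j
  proof (induction j)
    case (Suc j)
    then show ?case using N(1)[of "N + j"] by (simp add: algebra_simps)
  qed simp
  then have "real j * c \<le> K - s N" for j using N(2)[of "N + j"] by (smt (verit) le_add1)
  then show False using reals_Archimedean3[OF assms(1)] by (metis linorder_not_le)
qed

context
  fixes \<alpha> \<beta> A B :: real
  assumes \<alpha>: "\<alpha> > -1" and \<beta>: "\<beta> > -1"
  defines "A \<equiv> 1/4 - \<alpha>\<^sup>2" and "B \<equiv> 1/4 - \<beta>\<^sup>2"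
begin

private abbreviation (input) "\<gamma> \<equiv> jacobi_gamma \<alpha> \<beta>"
private abbreviation (input) "\<theta> \<equiv> jacobi_theta \<alpha> \<beta>"

lemma scaled_theta_bounds:
  assumes "1 \<le> k" "k \<le> n"
  shows "\<gamma> n * \<theta> n k \<in> {0<..<\<gamma> n * pi}" "jacobi_u \<alpha> \<beta> n (\<gamma> n * \<theta> n k) = 0"
    "jacobi_v \<alpha> \<beta> n (\<gamma> n * \<theta> n k) \<noteq> 0"
proof -
  have n: "n \<ge> 1" using assms by simp
  have g: "\<gamma> n > 0" by (rule jacobi_gamma_pos[OF \<alpha> \<beta> n])
  have th: "\<theta> n k \<in> jacobi_angles \<alpha> \<beta> n" by (rule jacobi_theta_in_angles[OF \<alpha> \<beta> assms])
  then show *: "\<gamma> n * \<theta> n k \<in> {0<..<\<gamma> n * pi}" using g by (simp add: jacobi_angles_def)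
  show "jacobi_u \<alpha> \<beta> n (\<gamma> n * \<theta> n k) = 0"
    using jacobi_u_zero_iff[OF \<alpha> \<beta> n *] th g by simp
  then show "jacobi_v \<alpha> \<beta> n (\<gamma> n * \<theta> n k) \<noteq> 0" by (rule jacobi_u_simple_zero[OF \<alpha> \<beta> n *])
qed

lemma jacobi_u_zeroE:
  assumes "n \<ge> 1" "\<phi> \<in> {0<..<\<gamma> n * pi}" "jacobi_u \<alpha> \<beta> n \<phi> = 0"
  obtains k where "k \<in> {1..n}" "\<phi> = \<gamma> n * \<theta> n k"
proof -
  have g: "\<gamma> n > 0" by (rule jacobi_gamma_pos[OF \<alpha> \<beta> assms(1)])
  have "\<phi> / \<gamma> n \<in> \<theta> n ` {1..n}"
    using assms jacobi_u_zero_iff[OF \<alpha> \<beta> assms(1,2)] jacobi_angles_eq_theta_image[OF \<alpha> \<beta>] by simp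
  then show thesis using that g by (auto simp: field_simps)
qed

lemma jacobi_u_nonzero_between:
  assumes "1 \<le> k" "k \<le> n" "\<phi> > 0" "\<phi> < \<gamma> n * \<theta> n k" "k > 1 \<Longrightarrow> \<gamma> n * \<theta> n (k - 1) < \<phi>"
  shows "jacobi_u \<alpha> \<beta> n \<phi> \<noteq> 0"
proof
  assume zero: "jacobi_u \<alpha> \<beta> n \<phi> = 0"
  have n: "n \<ge> 1" using assms by simp
  have g: "\<gamma> n > 0" by (rule jacobi_gamma_pos[OF \<alpha> \<beta> n])
  have "\<phi> \<in> {0<..<\<gamma> n * pi}" using assms scaled_theta_bounds(1)[OF assms(1,2)] by auto
  from jacobi_u_zeroE[OF n this zero] obtain i where i: "i \<in> {1..n}" "\<phi> = \<gamma> n * \<theta> n i" .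
  then have "i < k" using assms g jacobi_theta_less_iff[OF \<alpha> \<beta>, of i n k] by simp
  moreover have "k - 1 < i" if "k > 1"
  proof -
    have "k - 1 \<in> {1..n}" using that assms by auto
    then show ?thesis using jacobi_theta_less_iff[OF \<alpha> \<beta>, of "k - 1" n i] assms(5)[OF that] i g by simp
  qed
  ultimately show False using i by (cases "k > 1") auto
qed

text \<open>
  The zeros of \<open>u\<^sub>m\<close> cut \<open>(0, \<gamma>\<^sub>m \<theta>\<^sub>m\<^sub>,\<^sub>k]\<close> into pieces; the first piece starts at the singular point \<open>0\<close> and
  the others at zeros of \<open>u\<^sub>m\<close>.
\<close>
lemma sturm_next_zero:
  assumes k: "1 \<le> k" "k \<le> m" and n: "n \<ge> 1" and lt: "\<gamma> m * \<theta> m k < \<gamma> n * pi"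
  defines "a \<equiv> if k = 1 then 0 else \<gamma> m * \<theta> m (k - 1)"
  assumes le: "\<And>\<phi>. \<phi> \<in> {0<..<\<gamma> m * \<theta> m k} \<Longrightarrow> jacobi_q \<alpha> \<beta> m \<phi> \<le> jacobi_q \<alpha> \<beta> n \<phi>"
  shows "\<exists>\<phi>\<in>{a<..\<gamma> m * \<theta> m k}. jacobi_u \<alpha> \<beta> n \<phi> = 0"
    and "(\<And>\<phi>. \<phi> \<in> {0<..<\<gamma> m * \<theta> m k} \<Longrightarrow> jacobi_q \<alpha> \<beta> m \<phi> < jacobi_q \<alpha> \<beta> n \<phi>)
      \<Longrightarrow> \<exists>\<phi>\<in>{a<..<\<gamma> m * \<theta> m k}. jacobi_u \<alpha> \<beta> n \<phi> = 0"
proof -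
  have m: "m \<ge> 1" using k by simp
  have gm: "\<gamma> m > 0" by (rule jacobi_gamma_pos[OF \<alpha> \<beta> m])
  have a0: "a \<ge> 0"
  proof (cases "k = 1")
    case False
    then have "1 \<le> k - 1" "k - 1 \<le> m" using k by auto
    from scaled_theta_bounds(1)[OF this] show ?thesis by (simp add: a_def)
  qed (simp add: a_def)
  have ab: "a < \<gamma> m * \<theta> m k"
    using k gm scaled_theta_bounds(1)[OF k] jacobi_theta_less[OF \<alpha> \<beta>, of "k - 1" k m] by (auto simp: a_def)
  have sub: "{a<..\<gamma> m * \<theta> m k} \<subseteq> {0<..<\<gamma> m * pi}" "{a<..\<gamma> m * \<theta> m k} \<subseteq> {0<..<\<gamma> n * pi}"
    using a0 lt scaled_theta_bounds(1)[OF k] by auto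
  note Sm = jacobi_u_solves[OF \<alpha> \<beta> m] and Sn = jacobi_u_solves[OF \<alpha> \<beta> n]
  have left: "((\<lambda>x. jacobi_u \<alpha> \<beta> m x * jacobi_v \<alpha> \<beta> n x - jacobi_v \<alpha> \<beta> m x * jacobi_u \<alpha> \<beta> n x) \<longlongrightarrow> 0) (at_right a) \<or>
       solves_on (jacobi_q \<alpha> \<beta> m) (jacobi_u \<alpha> \<beta> m) (jacobi_v \<alpha> \<beta> m) {a} \<and>
       solves_on (jacobi_q \<alpha> \<beta> n) (jacobi_u \<alpha> \<beta> n) (jacobi_v \<alpha> \<beta> n) {a} \<and> jacobi_u \<alpha> \<beta> m a = 0"
  proof (cases "k = 1")
    case True
    then show ?thesis using jacobi_wronskian_at_0[OF \<alpha> \<beta> m n] by (simp add: a_def)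
  next
    case False
    then have k1: "1 \<le> k - 1" "k - 1 \<le> m" using k by auto
    have "a \<in> {0<..<\<gamma> m * pi}" "jacobi_u \<alpha> \<beta> m a = 0"
      using scaled_theta_bounds(1,2)[OF k1] False by (auto simp: a_def)
    moreover from this have "a \<in> {0<..<\<gamma> n * pi}" using ab lt by auto
    ultimately show ?thesis using solves_on_subset[OF Sm, of "{a}"] solves_on_subset[OF Sn, of "{a}"] by simp
  qed
  have nz: "jacobi_u \<alpha> \<beta> m x \<noteq> 0" if "x \<in> {a<..<\<gamma> m * \<theta> m k}" for x
    using that a0 by (intro jacobi_u_nonzero_between[OF k]) (auto simp: a_def split: if_splits)
  have le': "jacobi_q \<alpha> \<beta> m x \<le> jacobi_q \<alpha> \<beta> n x" if "x \<in> {a<..<\<gamma> m * \<theta> m k}" for x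
    using le[of x] that a0 by auto
  note comp = sturm_comparison[OF ab solves_on_subset[OF Sm sub(1)] solves_on_subset[OF Sn sub(2)]
      left nz scaled_theta_bounds(2,3)[OF k] le']
  show "\<exists>\<phi>\<in>{a<..\<gamma> m * \<theta> m k}. jacobi_u \<alpha> \<beta> n \<phi> = 0" by (rule comp(1))
  show "\<exists>\<phi>\<in>{a<..<\<gamma> m * \<theta> m k}. jacobi_u \<alpha> \<beta> n \<phi> = 0"
    if "\<And>\<phi>. \<phi> \<in> {0<..<\<gamma> m * \<theta> m k} \<Longrightarrow> jacobi_q \<alpha> \<beta> m \<phi> < jacobi_q \<alpha> \<beta> n \<phi>"
    using that a0 by (intro comp(2)) auto
qed

text \<open>
  Each of the \<open>k\<close> disjoint pieces between consecutive zeros of \<open>u\<^sub>m\<close> contains a zero of \<open>u\<^sub>n\<close>, so \<open>u\<^sub>n\<close>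
  has at least \<open>k\<close> zeros up to the \<open>k\<close>-th zero of \<open>u\<^sub>m\<close>.
\<close>
lemma scaled_theta_le:
  assumes k: "1 \<le> k" "k \<le> m" and n: "n \<ge> 1" and lt: "\<gamma> m * \<theta> m k < \<gamma> n * pi"
    and le: "\<And>\<phi>. \<phi> \<in> {0<..<\<gamma> m * \<theta> m k} \<Longrightarrow> jacobi_q \<alpha> \<beta> m \<phi> \<le> jacobi_q \<alpha> \<beta> n \<phi>"
  shows "\<gamma> n * \<theta> n k \<le> \<gamma> m * \<theta> m k"
proof -
  have gm: "\<gamma> m > 0" and gn: "\<gamma> n > 0" using jacobi_gamma_pos[OF \<alpha> \<beta>] k n by auto
  have mono: "\<gamma> m * \<theta> m i \<le> \<gamma> m * \<theta> m j" if "1 \<le> i" "i \<le> j" "j \<le> m" for i j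
    using that gm jacobi_theta_less[OF \<alpha> \<beta>, of i j m] by (cases "i = j") auto
  \<comment> \<open>The left ends of the pieces; the first piece starts at the singular point.\<close>
  define a where "a = (\<lambda>j. if j = 1 then 0 else \<gamma> m * \<theta> m (j - 1))"
  have a0: "a j \<ge> 0" if "j \<in> {1..k}" for j
  proof (cases "j = 1")
    case False
    then have "1 \<le> j - 1" "j - 1 \<le> m" using that k by auto
    from scaled_theta_bounds(1)[OF this] show ?thesis by (simp add: a_def)
  qed (simp add: a_def)
  have "\<exists>z\<in>{a j<..\<gamma> m * \<theta> m j}. jacobi_u \<alpha> \<beta> n z = 0" if j: "j \<in> {1..k}" for j
    unfolding a_def
  proof (rule sturm_next_zero(1)[OF _ _ n])
    have "\<gamma> m * \<theta> m j \<le> \<gamma> m * \<theta> m k" using j k by (intro mono) auto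
    then show "\<gamma> m * \<theta> m j < \<gamma> n * pi"
      "\<And>\<phi>. \<phi> \<in> {0<..<\<gamma> m * \<theta> m j} \<Longrightarrow> jacobi_q \<alpha> \<beta> m \<phi> \<le> jacobi_q \<alpha> \<beta> n \<phi>"
      using lt le by auto
  qed (use j k in auto)
  then obtain z where z: "\<And>j. j \<in> {1..k} \<Longrightarrow> z j \<in> {a j<..\<gamma> m * \<theta> m j}"
    "\<And>j. j \<in> {1..k} \<Longrightarrow> jacobi_u \<alpha> \<beta> n (z j) = 0" by metis
  have less: "z i < z j" if "i \<in> {1..k}" "j \<in> {1..k}" "i < j" for i j
  proof -
    have "z i \<le> \<gamma> m * \<theta> m i" using z(1)[OF that(1)] by simp
    also have "\<dots> \<le> a j" using that k by (auto simp: a_def intro!: mono)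
    also have "\<dots> < z j" using z(1)[OF that(2)] by simp
    finally show ?thesis .
  qed
  have top: "z j \<le> \<gamma> m * \<theta> m k" if "j \<in> {1..k}" for j
    using z(1)[OF that] mono[of j k] that k by auto
  have "inj_on (\<lambda>j. z j / \<gamma> n) {1..k}"
    using less gn by (intro inj_onI) (metis divide_cancel_right less_irrefl linorder_neqE_nat)
  then have card: "card ((\<lambda>j. z j / \<gamma> n) ` {1..k}) = k" by (simp add: card_image)
  have "\<theta> n k \<le> \<gamma> m * \<theta> m k / \<gamma> n"
  proof (rule jacobi_theta_le_if_angles_below[OF \<alpha> \<beta> _ k(1)])
    show "(\<lambda>j. z j / \<gamma> n) ` {1..k} \<subseteq> jacobi_angles \<alpha> \<beta> n"
    proof safe
      fix j assume j: "j \<in> {1..k}"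
      have "z j \<in> {0<..<\<gamma> n * pi}" using z(1)[OF j] a0[OF j] top[OF j] lt by auto
      then show "z j / \<gamma> n \<in> jacobi_angles \<alpha> \<beta> n" using jacobi_u_zero_iff[OF \<alpha> \<beta> n] z(2)[OF j] by blast
    qed
  qed (use card top gn in \<open>auto intro!: divide_right_mono\<close>)
  then show ?thesis using gn by (simp add: field_simps)
qed

lemma scaled_theta_1_less:
  assumes m: "m \<ge> 1" and n: "n \<ge> 1" and lt: "\<gamma> m * \<theta> m 1 < \<gamma> n * pi"
    and less: "\<And>\<phi>. \<phi> \<in> {0<..<\<gamma> m * \<theta> m 1} \<Longrightarrow> jacobi_q \<alpha> \<beta> m \<phi> < jacobi_q \<alpha> \<beta> n \<phi>"
  shows "\<gamma> n * \<theta> n 1 < \<gamma> m * \<theta> m 1"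
proof -
  have gn: "\<gamma> n > 0" by (rule jacobi_gamma_pos[OF \<alpha> \<beta> n])
  from sturm_next_zero(2)[OF order_refl m n lt less_imp_le[OF less] less]
  obtain z where z: "z \<in> {0<..<\<gamma> m * \<theta> m 1}" "jacobi_u \<alpha> \<beta> n z = 0" by auto
  then have "z / \<gamma> n \<in> jacobi_angles \<alpha> \<beta> n" using jacobi_u_zero_iff[OF \<alpha> \<beta> n, of z] lt by auto
  then have "\<theta> n 1 \<le> z / \<gamma> n" by (intro jacobi_theta_le_if_angles_below[OF \<alpha> \<beta>, of "{z / \<gamma> n}"]) auto
  then show ?thesis using gn z by (auto simp: field_simps)
qed

lemma gamma_Suc: "\<gamma> (n + 1) = \<gamma> n + 1"
  by (simp add: jacobi_gamma_def)

lemma eventually_gamma_gt: "\<forall>\<^sub>F n in sequentially. \<gamma> n > C"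
proof -
  have "filterlim (\<lambda>n. real n + (\<alpha> + \<beta> + 1) / 2) at_top sequentially" by real_asymp
  then show ?thesis by (simp add: jacobi_gamma_def[abs_def] filterlim_at_top_dense)
qed

lemma jacobi_q_mono:
  assumes "\<phi> > 0"
    and "potential A B (\<phi> / (2 * \<gamma> m)) \<le> potential A B (\<phi> / (2 * \<gamma> n))"
  shows "jacobi_q \<alpha> \<beta> m \<phi> \<le> jacobi_q \<alpha> \<beta> n \<phi>"
  using assms unfolding jacobi_q_def A_def B_def by (simp add: divide_right_mono)

lemma jacobi_q_strict_mono:
  assumes "\<phi> > 0"
    and "potential A B (\<phi> / (2 * \<gamma> m)) < potential A B (\<phi> / (2 * \<gamma> n))"
  shows "jacobi_q \<alpha> \<beta> m \<phi> < jacobi_q \<alpha> \<beta> n \<phi>"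
  using assms unfolding jacobi_q_def A_def B_def by (simp add: divide_strict_right_mono)

lemma half_angle_Suc:
  assumes "n \<ge> 1" "\<phi> > 0" "\<phi> < \<gamma> n * pi"
  shows "0 < \<phi> / (2 * \<gamma> (n + 1))" "\<phi> / (2 * \<gamma> (n + 1)) < \<phi> / (2 * \<gamma> n)" "\<phi> / (2 * \<gamma> n) < pi / 2"
proof -
  have g: "\<gamma> n > 0" by (rule jacobi_gamma_pos[OF \<alpha> \<beta> assms(1)])
  show "0 < \<phi> / (2 * \<gamma> (n + 1))" unfolding gamma_Suc using g assms by simp
  show "\<phi> / (2 * \<gamma> (n + 1)) < \<phi> / (2 * \<gamma> n)"
    unfolding gamma_Suc using g assms by (intro divide_strict_left_mono) auto
  show "\<phi> / (2 * \<gamma> n) < pi / 2" using g assms by (simp add: field_simps)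
qed

theorem scaled_theta_increasing:
  assumes "B \<ge> 0" "A + 3 * B \<ge> 0" "n \<ge> 1" "k \<in> {1..n}"
  shows "\<gamma> n * \<theta> n k \<le> \<gamma> (n + 1) * \<theta> (n + 1) k"
proof (cases "\<gamma> (n + 1) * \<theta> (n + 1) k < \<gamma> n * pi")
  case True
  then show ?thesis
  proof (intro scaled_theta_le jacobi_q_mono)
    fix \<phi> assume \<phi>: "\<phi> \<in> {0<..<\<gamma> (n + 1) * \<theta> (n + 1) k}"
    then show "0 < \<phi>" by simp
    have "\<phi> < \<gamma> n * pi" using \<phi> True by simp
    from half_angle_Suc[OF assms(3) \<open>0 < \<phi>\<close> this]
    show "potential A B (\<phi> / (2 * \<gamma> (n + 1))) \<le> potential A B (\<phi> / (2 * \<gamma> n))"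
      by (intro potential_mono assms) auto
  qed (use assms in auto)
next
  case False
  \<comment> \<open>All scaled zeros of degree \<open>n\<close> lie below \<open>\<gamma>\<^sub>n \<pi>\<close>.\<close>
  have "\<gamma> n * \<theta> n k < \<gamma> n * pi" using scaled_theta_bounds(1)[of k n] assms by auto
  then show ?thesis using False by simp
qed

theorem scaled_theta_decreasing:
  assumes "B \<le> 0" "A + 3 * B \<le> 0" "n \<ge> 1" "k \<in> {1..n}"
  shows "\<gamma> (n + 1) * \<theta> (n + 1) k \<le> \<gamma> n * \<theta> n k"
proof (intro scaled_theta_le jacobi_q_mono)
  have top: "\<gamma> n * \<theta> n k < \<gamma> n * pi" using scaled_theta_bounds(1)[of k n] assms by auto
  then show "\<gamma> n * \<theta> n k < \<gamma> (n + 1) * pi" unfolding gamma_Suc distrib_right using pi_gt_zero by linarith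
  fix \<phi> assume \<phi>: "\<phi> \<in> {0<..<\<gamma> n * \<theta> n k}"
  then show "0 < \<phi>" by simp
  have "\<phi> < \<gamma> n * pi" using \<phi> top by simp
  from half_angle_Suc[OF assms(3) \<open>0 < \<phi>\<close> this]
  show "potential A B (\<phi> / (2 * \<gamma> n)) \<le> potential A B (\<phi> / (2 * \<gamma> (n + 1)))"
    by (intro potential_antimono assms) auto
qed (use assms in auto)

text \<open>
  For \<open>\<phi> \<ge> 2 C\<close> and small \<open>t\<close> the coefficient is at least \<open>1/4\<close>, so a zero occurs within the following
  length \<open>2 \<pi>\<close>.
\<close>
lemma scaled_theta_1_bounded:
  obtains K where "K > 0" "\<forall>\<^sub>F n in sequentially. \<gamma> n * \<theta> n 1 \<le> K"
proof -
  obtain \<delta> where d: "0 < \<delta>" "\<delta> < pi/2" "\<And>t. 0 < t \<Longrightarrow> t < \<delta> \<Longrightarrow> \<bar>potential A B t - A\<bar> < 1"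
    by (rule potential_near_0[of 1 A B]) auto
  define C where "C = \<bar>A\<bar> + 1"
  \<comment> \<open>The zero is found in \<open>(2 C, 2 C + 2 \<pi>]\<close>.\<close>
  define K where "K = 2 * C + 2 * pi"
  have C: "C \<ge> 1" and K: "K > 0" by (auto simp: C_def K_def add_pos_pos)
  have "\<forall>\<^sub>F n in sequentially. \<gamma> n * \<theta> n 1 \<le> K"
    using eventually_gamma_gt[of "K / (2 * \<delta>)"] eventually_ge_at_top[of 1]
  proof eventually_elim
    case (elim n)
    have g: "\<gamma> n > 0" by (rule jacobi_gamma_pos[OF \<alpha> \<beta> elim(2)])
    have K\<delta>: "K < 2 * \<delta> * \<gamma> n" using elim(1) d(1) by (simp add: field_simps)
    also have "\<dots> < \<gamma> n * pi" using d(2) g by simp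
    finally have K\<pi>: "K < \<gamma> n * pi" .
    have "\<exists>\<phi>\<in>{2 * C<..2 * C + pi / (1/2)}. jacobi_u \<alpha> \<beta> n \<phi> = 0"
    proof (rule zero_within_half_period)
      show "solves_on (jacobi_q \<alpha> \<beta> n) (jacobi_u \<alpha> \<beta> n) (jacobi_v \<alpha> \<beta> n) {2 * C..2 * C + pi / (1/2)}"
        by (rule solves_on_subset[OF jacobi_u_solves[OF \<alpha> \<beta> elim(2)]]) (use C K\<pi> in \<open>auto simp: K_def\<close>)
      fix \<phi> assume \<phi>: "\<phi> \<in> {2 * C<..<2 * C + pi / (1/2)}"
      then have "\<phi> / (2 * \<gamma> n) < \<delta>" "0 < \<phi> / (2 * \<gamma> n)" using K\<delta> g C by (auto simp: K_def field_simps)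
      from d(3)[OF this(2,1)] have pot: "potential A B (\<phi> / (2 * \<gamma> n)) \<ge> - C" by (simp add: C_def)
      show "(1/2)\<^sup>2 \<le> jacobi_q \<alpha> \<beta> n \<phi>"
        unfolding jacobi_q_def A_def[symmetric] B_def[symmetric]
        by (rule frequency_bound[OF C _ pot]) (use \<phi> in simp)
    qed simp
    then obtain \<phi> where \<phi>: "2 * C < \<phi>" "\<phi> \<le> K" "jacobi_u \<alpha> \<beta> n \<phi> = 0" by (auto simp: K_def)
    then have "\<phi> / \<gamma> n \<in> jacobi_angles \<alpha> \<beta> n" using jacobi_u_zero_iff[OF \<alpha> \<beta> elim(2), of \<phi>] K\<pi> C by auto
    then have "\<theta> n 1 \<le> \<phi> / \<gamma> n" by (intro jacobi_theta_le_if_angles_below[OF \<alpha> \<beta>, of "{\<phi> / \<gamma> n}"]) auto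
    then have "\<gamma> n * \<theta> n 1 \<le> \<phi>" using g by (simp add: field_simps)
    then show "\<gamma> n * \<theta> n 1 \<le> K" using \<phi>(2) by simp
  qed
  with K show thesis by (rule that)
qed

text \<open>
  On a bounded range of \<open>\<phi>\<close> the variable \<open>t\<close> is as small as desired for large \<open>n\<close>, and near \<open>0\<close> the
  potential is strictly monotone in the direction given by the sign of \<open>A + 3 B\<close>.
\<close>
lemma first_theta_comparison:
  assumes "A + 3 * B \<noteq> 0"
  obtains n where "n \<ge> 1" "A + 3 * B < 0 \<Longrightarrow> \<gamma> (n + 1) * \<theta> (n + 1) 1 < \<gamma> n * \<theta> n 1"
    "A + 3 * B > 0 \<Longrightarrow> \<gamma> n * \<theta> n 1 < \<gamma> (n + 1) * \<theta> (n + 1) 1"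
proof -
  obtain K where K: "K > 0" "\<forall>\<^sub>F n in sequentially. \<gamma> n * \<theta> n 1 \<le> K" by (rule scaled_theta_1_bounded)
  obtain \<delta> where d: "0 < \<delta>" "\<delta> < pi/2"
    "\<And>s t. A + 3 * B > 0 \<Longrightarrow> 0 < s \<Longrightarrow> s < t \<Longrightarrow> t < \<delta> \<Longrightarrow> potential A B s < potential A B t"
    "\<And>s t. A + 3 * B < 0 \<Longrightarrow> 0 < s \<Longrightarrow> s < t \<Longrightarrow> t < \<delta> \<Longrightarrow> potential A B t < potential A B s"
  proof (cases "A + 3 * B > 0")
    case True
    from potential_strict_mono_near_0[OF True] that True show thesis by (metis order_less_asym)
  next
    case False
    then have "(- A) + 3 * (- B) > 0" using assms by simp
    from potential_strict_mono_near_0[OF this] that False show thesis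
      unfolding potential_uminus by (metis neg_less_iff_less)
  qed
  have "\<forall>\<^sub>F n in sequentially. \<gamma> n * \<theta> n 1 \<le> K \<and> \<gamma> (n + 1) * \<theta> (n + 1) 1 \<le> K \<and> \<gamma> n > K / (2 * \<delta>) \<and> n \<ge> 1"
    using K(2) K(2)[unfolded eventually_sequentially_Suc[of "\<lambda>n. \<gamma> n * \<theta> n 1 \<le> K", symmetric]]
      eventually_gamma_gt[of "K / (2 * \<delta>)"] eventually_ge_at_top[of 1]
    by eventually_elim auto
  then obtain n where n: "\<gamma> n * \<theta> n 1 \<le> K" "\<gamma> (n + 1) * \<theta> (n + 1) 1 \<le> K" "\<gamma> n > K / (2 * \<delta>)" "n \<ge> 1"
    by (auto simp: eventually_sequentially)
  have g: "\<gamma> n > 0" by (rule jacobi_gamma_pos[OF \<alpha> \<beta> n(4)])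
  have K\<delta>: "K < 2 * \<delta> * \<gamma> n" using n(3) d(1) by (simp add: field_simps)
  also have "\<dots> < \<gamma> n * pi" using d(2) g by simp
  finally have K\<pi>: "K < \<gamma> n * pi" .
  have small: "0 < \<phi> / (2 * \<gamma> (n + 1))" "\<phi> / (2 * \<gamma> (n + 1)) < \<phi> / (2 * \<gamma> n)" "\<phi> / (2 * \<gamma> n) < \<delta>"
    if "0 < \<phi>" "\<phi> < K" for \<phi>
    using half_angle_Suc[OF n(4), of \<phi>] that K\<pi> K\<delta> g by (auto simp: field_simps)
  show thesis
  proof (rule that[OF n(4)])
    assume neg: "A + 3 * B < 0"
    show "\<gamma> (n + 1) * \<theta> (n + 1) 1 < \<gamma> n * \<theta> n 1"
    proof (intro scaled_theta_1_less jacobi_q_strict_mono d(4)[OF neg] small)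
      show "\<gamma> n * \<theta> n 1 < \<gamma> (n + 1) * pi"
        using n K\<pi> pi_gt_zero unfolding gamma_Suc distrib_right by linarith
    qed (use n in auto)
  next
    assume pos: "A + 3 * B > 0"
    show "\<gamma> n * \<theta> n 1 < \<gamma> (n + 1) * \<theta> (n + 1) 1"
      using n K\<pi> by (intro scaled_theta_1_less jacobi_q_strict_mono d(3)[OF pos] small) auto
  qed
qed

text \<open>
  Reflection at the right endpoint replaces \<open>t\<close> by \<open>\<pi>/2 - t\<close>, which exchanges sine and cosine and thus the
  roles of \<open>\<alpha>\<close> and \<open>\<beta>\<close>.
\<close>
lemma jacobi_q_reflect:
  assumes "n \<ge> 1" "s \<in> {0<..<\<gamma> n * pi}"
  shows "jacobi_q \<alpha> \<beta> n (\<gamma> n * pi - s) = 1 + potential B A (s / (2 * \<gamma> n)) / s\<^sup>2"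
proof -
  have g: "\<gamma> n > 0" by (rule jacobi_gamma_pos[OF \<alpha> \<beta> assms(1)])
  have h: "(\<gamma> n * pi - s) / (2 * \<gamma> n) = pi / 2 - s / (2 * \<gamma> n)" using g by (simp add: field_simps)
  have pot: "potential a b (x / (2 * \<gamma> n)) / x\<^sup>2 =
      (a / (sin (x / (2 * \<gamma> n)))\<^sup>2 + b / (cos (x / (2 * \<gamma> n)))\<^sup>2) / (2 * \<gamma> n)\<^sup>2" if "x \<noteq> 0" for a b x
    using that by (simp add: potential_def power_divide add_divide_distrib mult.commute)
  have "sin (pi / 2 - x) = cos x" "cos (pi / 2 - x) = sin x" for x :: real
    by (simp_all add: sin_diff cos_diff)
  note trig = this
  have nz: "\<gamma> n * pi - s \<noteq> 0" "s \<noteq> 0" using assms by auto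
  show ?thesis
    unfolding jacobi_q_def A_def[symmetric] B_def[symmetric] pot[OF nz(1)] pot[OF nz(2)]
    unfolding h trig
    by (simp add: add.commute)
qed

text \<open>
  As at the left endpoint, but with two consecutive intervals of length \<open>2 \<pi>\<close>.
\<close>
lemma last_two_thetas_bounded:
  obtains K where "K > 0" "\<forall>\<^sub>F n in sequentially. n \<ge> 2 \<and> \<gamma> n * pi - \<gamma> n * \<theta> n (n - 1) \<le> K"
proof -
  obtain \<delta> where d: "0 < \<delta>" "\<delta> < pi/2" "\<And>t. 0 < t \<Longrightarrow> t < \<delta> \<Longrightarrow> \<bar>potential B A t - B\<bar> < 1"
    by (rule potential_near_0[of 1 B A]) auto
  define C where "C = \<bar>B\<bar> + 1"
  \<comment> \<open>Room for two intervals of length \<open>2 \<pi>\<close> at distance \<open>2 C\<close> from the endpoint.\<close>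
  define K where "K = 2 * C + 4 * pi"
  have C: "C \<ge> 1" and K: "K > 0" by (auto simp: C_def K_def add_pos_pos)
  have "\<forall>\<^sub>F n in sequentially. n \<ge> 2 \<and> \<gamma> n * pi - \<gamma> n * \<theta> n (n - 1) \<le> K"
    using eventually_gamma_gt[of "K / (2 * \<delta>)"] eventually_ge_at_top[of 2]
  proof eventually_elim
    case (elim n)
    have n: "n \<ge> 1" using elim by simp
    have g: "\<gamma> n > 0" by (rule jacobi_gamma_pos[OF \<alpha> \<beta> n])
    have K\<delta>: "K < 2 * \<delta> * \<gamma> n" using elim(1) d(1) by (simp add: field_simps)
    also have "\<dots> < \<gamma> n * pi" using d(2) g by simp
    finally have K\<pi>: "K < \<gamma> n * pi" .
    have zero: "\<exists>\<phi>\<in>{a<..a + pi / (1/2)}. jacobi_u \<alpha> \<beta> n \<phi> = 0"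
      if a: "\<gamma> n * pi - K \<le> a" "a + 2 * pi \<le> \<gamma> n * pi - 2 * C" for a
    proof (rule zero_within_half_period)
      show "solves_on (jacobi_q \<alpha> \<beta> n) (jacobi_u \<alpha> \<beta> n) (jacobi_v \<alpha> \<beta> n) {a..a + pi / (1/2)}"
        by (rule solves_on_subset[OF jacobi_u_solves[OF \<alpha> \<beta> n]]) (use C K\<pi> a in auto)
      fix \<phi> assume \<phi>: "\<phi> \<in> {a<..<a + pi / (1/2)}"
      define s where "s = \<gamma> n * pi - \<phi>"
      have s: "s \<in> {0<..<\<gamma> n * pi}" "s < K" "s \<ge> 2 * C" "\<phi> = \<gamma> n * pi - s" using \<phi> a C K\<pi> by (auto simp: s_def)
      then have "s / (2 * \<gamma> n) < \<delta>" "0 < s / (2 * \<gamma> n)" using K\<delta> g by (auto simp: field_simps)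
      from d(3)[OF this(2,1)] have pot: "potential B A (s / (2 * \<gamma> n)) \<ge> - C" by (simp add: C_def)
      show "(1/2)\<^sup>2 \<le> jacobi_q \<alpha> \<beta> n \<phi>"
        unfolding s(4) jacobi_q_reflect[OF n s(1)] by (rule frequency_bound[OF C s(3) pot])
    qed simp
    obtain x where x: "\<gamma> n * pi - K < x" "x \<le> \<gamma> n * pi - K + 2 * pi" "jacobi_u \<alpha> \<beta> n x = 0"
      using zero[of "\<gamma> n * pi - K"] by (auto simp: K_def)
    obtain y where y: "\<gamma> n * pi - K + 2 * pi < y" "y \<le> \<gamma> n * pi - 2 * C" "jacobi_u \<alpha> \<beta> n y = 0"
      using zero[of "\<gamma> n * pi - K + 2 * pi"] by (auto simp: K_def)
    have "x / \<gamma> n \<in> jacobi_angles \<alpha> \<beta> n" "y / \<gamma> n \<in> jacobi_angles \<alpha> \<beta> n"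
      using jacobi_u_zero_iff[OF \<alpha> \<beta> n, of x] jacobi_u_zero_iff[OF \<alpha> \<beta> n, of y] x y K\<pi> C
      by (auto simp: K_def)
    moreover have "x / \<gamma> n \<noteq> y / \<gamma> n" using x y g by auto
    moreover have "(\<gamma> n * pi - K) / \<gamma> n \<le> x / \<gamma> n" "(\<gamma> n * pi - K) / \<gamma> n \<le> y / \<gamma> n"
      using x y g by (auto intro!: divide_right_mono)
    ultimately have "(\<gamma> n * pi - K) / \<gamma> n \<le> \<theta> n (n - 1)"
      using elim by (intro jacobi_theta_ge_if_angles_above[OF \<alpha> \<beta>, of "{x / \<gamma> n, y / \<gamma> n}"]) auto
    then show "n \<ge> 2 \<and> \<gamma> n * pi - \<gamma> n * \<theta> n (n - 1) \<le> K" using g elim by (simp add: field_simps)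
  qed
  with K show thesis by (rule that)
qed

text \<open>
  At bounded distance from the right endpoint and for large \<open>n\<close> the coefficient stays below \<open>1 - e\<close> or above
  \<open>1 + e\<close> for a fixed \<open>e > 0\<close>, according to the sign of \<open>B\<close>.  So the distance of consecutive zeros
  there compares with \<open>\<pi> / sqrt (1 - e) > \<pi>\<close> or with \<open>\<pi> / sqrt (1 + e) < \<pi>\<close>.
\<close>
lemma last_gap:
  assumes "B \<noteq> 0"
  obtains c where "c > 0"
    "B < 0 \<longrightarrow> (\<forall>\<^sub>F n in sequentially. \<gamma> n * \<theta> n n - \<gamma> n * \<theta> n (n - 1) \<ge> pi + c)"
    "B > 0 \<longrightarrow> (\<forall>\<^sub>F n in sequentially. \<gamma> n * \<theta> n n - \<gamma> n * \<theta> n (n - 1) \<le> pi - c)"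
proof -
  obtain K where K: "K > 0" "\<forall>\<^sub>F n in sequentially. n \<ge> 2 \<and> \<gamma> n * pi - \<gamma> n * \<theta> n (n - 1) \<le> K"
    by (rule last_two_thetas_bounded)
  obtain \<delta> where d: "0 < \<delta>" "\<delta> < pi/2" "\<And>t. 0 < t \<Longrightarrow> t < \<delta> \<Longrightarrow> \<bar>potential B A t - B\<bar> < \<bar>B\<bar> / 2"
    by (rule potential_near_0[of "\<bar>B\<bar> / 2" B A]) (use assms in auto)
  \<comment> \<open>The cap \<open>1/2\<close> keeps \<open>1 - e\<close> positive.\<close>
  define e where "e = min (1/2) (\<bar>B\<bar> / 2 / K\<^sup>2)"
  have e: "0 < e" "e \<le> 1/2" using assms K by (auto simp: e_def)
  have q: "B < 0 \<longrightarrow> jacobi_q \<alpha> \<beta> n \<phi> \<le> 1 - e" "B > 0 \<longrightarrow> 1 + e \<le> jacobi_q \<alpha> \<beta> n \<phi>"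
    if n: "n \<ge> 1" and big: "\<gamma> n > K / (2 * \<delta>)" and \<phi>: "\<gamma> n * pi - K < \<phi>" "0 < \<phi>" "\<phi> < \<gamma> n * pi" for n \<phi>
  proof -
    define s where "s = \<gamma> n * pi - \<phi>"
    have s: "s \<in> {0<..<\<gamma> n * pi}" "s < K" "\<phi> = \<gamma> n * pi - s" using \<phi> by (auto simp: s_def)
    have g: "\<gamma> n > 0" by (rule jacobi_gamma_pos[OF \<alpha> \<beta> n])
    have "K < 2 * \<delta> * \<gamma> n" using big d(1) by (simp add: field_simps)
    then have "s / (2 * \<gamma> n) < \<delta>" "0 < s / (2 * \<gamma> n)" using s g by (auto simp: field_simps)
    note pot = d(3)[OF this(2,1)]
    have "\<bar>B\<bar> / 2 / K\<^sup>2 \<le> \<bar>B\<bar> / 2 / s\<^sup>2"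
      using s K by (intro divide_left_mono power_mono) auto
    then have le: "e \<le> \<bar>B\<bar> / 2 / s\<^sup>2" by (simp add: e_def)
    show "B < 0 \<longrightarrow> jacobi_q \<alpha> \<beta> n \<phi> \<le> 1 - e"
    proof
      assume "B < 0"
      then have "potential B A (s / (2 * \<gamma> n)) / s\<^sup>2 \<le> (- (\<bar>B\<bar> / 2)) / s\<^sup>2" using pot by (intro divide_right_mono) auto
      then show "jacobi_q \<alpha> \<beta> n \<phi> \<le> 1 - e" unfolding s(3) jacobi_q_reflect[OF n s(1)] using le by simp
    qed
    show "B > 0 \<longrightarrow> 1 + e \<le> jacobi_q \<alpha> \<beta> n \<phi>"
    proof
      assume "B > 0"
      then have "(\<bar>B\<bar> / 2) / s\<^sup>2 \<le> potential B A (s / (2 * \<gamma> n)) / s\<^sup>2" using pot by (intro divide_right_mono zero_le_power2) linarith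
      then show "1 + e \<le> jacobi_q \<alpha> \<beta> n \<phi>" unfolding s(3) jacobi_q_reflect[OF n s(1)] using le by simp
    qed
  qed
  have ev: "\<forall>\<^sub>F n in sequentially. n \<ge> 2 \<and> \<gamma> n * pi - \<gamma> n * \<theta> n (n - 1) \<le> K \<and> \<gamma> n > K / (2 * \<delta>)"
    using K(2) eventually_gamma_gt[of "K / (2 * \<delta>)"] by eventually_elim auto
  define c where "c = (if B < 0 then pi / sqrt (1 - e) - pi else pi - pi / sqrt (1 + e))"
  have "0 < sqrt (1 - e)" "sqrt (1 - e) < 1" "1 < sqrt (1 + e)" using e by auto
  then have "pi / sqrt (1 - e) > pi" "pi / sqrt (1 + e) < pi"
    by (simp_all add: pos_less_divide_eq pos_divide_less_eq)
  then have "c > 0" by (simp add: c_def)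
  moreover have "\<forall>\<^sub>F n in sequentially. \<gamma> n * \<theta> n n - \<gamma> n * \<theta> n (n - 1) \<ge> pi + c" if neg: "B < 0"
    using ev
  proof eventually_elim
    case (elim n)
    have n: "n \<ge> 1" "1 \<le> n - 1" "n - 1 \<le> n" "n - 1 < n" using elim by auto
    have g: "\<gamma> n > 0" by (rule jacobi_gamma_pos[OF \<alpha> \<beta> n(1)])
    note b = scaled_theta_bounds[OF n(2,3)] and b' = scaled_theta_bounds[OF n(1) order_refl]
    have "pi / sqrt (1 - e) \<le> \<gamma> n * \<theta> n n - \<gamma> n * \<theta> n (n - 1)"
    proof (rule zero_gap_at_least_half_period)
      show "\<gamma> n * \<theta> n (n - 1) < \<gamma> n * \<theta> n n" using g n jacobi_theta_less[OF \<alpha> \<beta> n(2,4)] by simp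
      show "solves_on (jacobi_q \<alpha> \<beta> n) (jacobi_u \<alpha> \<beta> n) (jacobi_v \<alpha> \<beta> n) {\<gamma> n * \<theta> n (n - 1)..\<gamma> n * \<theta> n n}"
        by (rule solves_on_subset[OF jacobi_u_solves[OF \<alpha> \<beta> n(1)]]) (use b(1) b'(1) in auto)
      show "jacobi_u \<alpha> \<beta> n \<phi> \<noteq> 0" if "\<phi> \<in> {\<gamma> n * \<theta> n (n - 1)<..<\<gamma> n * \<theta> n n}" for \<phi>
        using that b(1) by (intro jacobi_u_nonzero_between[OF n(1) order_refl]) auto
      show "jacobi_q \<alpha> \<beta> n \<phi> \<le> (sqrt (1 - e))\<^sup>2" if "\<phi> \<in> {\<gamma> n * \<theta> n (n - 1)<..<\<gamma> n * \<theta> n n}" for \<phi>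
        using q(1)[OF n(1), of \<phi>] neg that elim b(1) b'(1) e by auto
    qed (use b b' e in auto)
    then show "\<gamma> n * \<theta> n n - \<gamma> n * \<theta> n (n - 1) \<ge> pi + c" using neg by (simp add: c_def)
  qed
  moreover have "\<forall>\<^sub>F n in sequentially. \<gamma> n * \<theta> n n - \<gamma> n * \<theta> n (n - 1) \<le> pi - c" if pos: "B > 0"
    using ev
  proof eventually_elim
    case (elim n)
    have n: "n \<ge> 1" "1 \<le> n - 1" "n - 1 \<le> n" using elim by auto
    note b = scaled_theta_bounds[OF n(2,3)] and b' = scaled_theta_bounds[OF n(1) order_refl]
    define a where "a = \<gamma> n * \<theta> n (n - 1)"
    have "\<gamma> n * \<theta> n n \<le> a + pi / sqrt (1 + e)"
    proof (rule ccontr)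
      assume gt: "\<not> ?thesis"
      have "\<exists>\<phi>\<in>{a<..a + pi / sqrt (1 + e)}. jacobi_u \<alpha> \<beta> n \<phi> = 0"
      proof (rule zero_within_half_period)
        show "solves_on (jacobi_q \<alpha> \<beta> n) (jacobi_u \<alpha> \<beta> n) (jacobi_v \<alpha> \<beta> n) {a..a + pi / sqrt (1 + e)}"
          by (rule solves_on_subset[OF jacobi_u_solves[OF \<alpha> \<beta> n(1)]]) (use b(1) b'(1) gt in \<open>auto simp: a_def\<close>)
        show "(sqrt (1 + e))\<^sup>2 \<le> jacobi_q \<alpha> \<beta> n \<phi>" if "\<phi> \<in> {a<..<a + pi / sqrt (1 + e)}" for \<phi>
          using q(2)[OF n(1), of \<phi>] pos that elim b(1) b'(1) e gt by (auto simp: a_def)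
      qed (use e in auto)
      then obtain \<phi> where "a < \<phi>" "\<phi> \<le> a + pi / sqrt (1 + e)" "jacobi_u \<alpha> \<beta> n \<phi> = 0" by auto
      then show False
        using gt b(1) jacobi_u_nonzero_between[OF n(1) order_refl, of \<phi>] by (auto simp: a_def)
    qed
    then show "\<gamma> n * \<theta> n n - \<gamma> n * \<theta> n (n - 1) \<le> pi - c" using pos by (simp add: c_def a_def)
  qed
  ultimately show thesis by (intro that) auto
qed

text \<open>
  Let \<open>s\<^sub>n\<close> be the distance of the last scaled zero from \<open>\<gamma>\<^sub>n \<pi>\<close>.  If \<open>B < 0\<close>, the last but one scaled zero
  of degree \<open>n + 1\<close> has distance at least \<open>s\<^sub>n\<^sub>+\<^sub>1 + \<pi> + c\<close> from \<open>\<gamma>\<^sub>n\<^sub>+\<^sub>1 \<pi> = \<gamma>\<^sub>n \<pi> + \<pi>\<close>.  If it were never to the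
  left of the last scaled zero of degree \<open>n\<close>, that distance would be at most \<open>s\<^sub>n + \<pi>\<close>, and \<open>s\<^sub>n\<close> would
  lose \<open>c\<close> at every step.  For \<open>B > 0\<close> the same argument makes the bounded sequence \<open>s\<^sub>n\<close> gain \<open>c\<close>.
\<close>
lemma last_theta_comparison:
  assumes "B \<noteq> 0"
  shows "B < 0 \<Longrightarrow> \<exists>n\<ge>1. \<gamma> (n + 1) * \<theta> (n + 1) n < \<gamma> n * \<theta> n n"
    and "B > 0 \<Longrightarrow> \<exists>n\<ge>1. \<gamma> n * \<theta> n n < \<gamma> (n + 1) * \<theta> (n + 1) n"
proof -
  obtain c where c: "c > 0"
    "B < 0 \<longrightarrow> (\<forall>\<^sub>F n in sequentially. \<gamma> n * \<theta> n n - \<gamma> n * \<theta> n (n - 1) \<ge> pi + c)"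
    "B > 0 \<longrightarrow> (\<forall>\<^sub>F n in sequentially. \<gamma> n * \<theta> n n - \<gamma> n * \<theta> n (n - 1) \<le> pi - c)"
    by (rule last_gap[OF assms])
  define s where "s = (\<lambda>n. \<gamma> n * pi - \<gamma> n * \<theta> n n)"
  have s0: "\<forall>\<^sub>F n in sequentially. - s n \<le> 0"
    using eventually_ge_at_top[of 1]
  proof eventually_elim
    case (elim n)
    then show ?case using scaled_theta_bounds(1)[OF elim order_refl] by (simp add: s_def)
  qed
  obtain K where K: "\<forall>\<^sub>F n in sequentially. n \<ge> 2 \<and> \<gamma> n * pi - \<gamma> n * \<theta> n (n - 1) \<le> K"
    by (rule last_two_thetas_bounded)
  have sK: "\<forall>\<^sub>F n in sequentially. s n \<le> K"
    using K
  proof eventually_elim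
    case (elim n)
    then have n: "1 \<le> n - 1" "n - 1 < n" "n \<ge> 1" by auto
    have "\<gamma> n * \<theta> n (n - 1) < \<gamma> n * \<theta> n n"
      using jacobi_theta_less[OF \<alpha> \<beta> n(1,2) order_refl] jacobi_gamma_pos[OF \<alpha> \<beta> n(3)] by simp
    then show ?case using elim by (simp add: s_def)
  qed
  show "\<exists>n\<ge>1. \<gamma> (n + 1) * \<theta> (n + 1) n < \<gamma> n * \<theta> n n" if "B < 0"
  proof (rule ccontr)
    assume up: "\<not> ?thesis"
    have "\<forall>\<^sub>F n in sequentially. - s n + c \<le> - s (n + 1)"
      using c(2)[rule_format, OF that, THEN eventually_sequentially_Suc[of "\<lambda>n. \<gamma> n * \<theta> n n - \<gamma> n * \<theta> n (n - 1) \<ge> pi + c", THEN iffD2]]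
        eventually_ge_at_top[of 1]
    proof eventually_elim
      case (elim n)
      have "\<gamma> n * \<theta> n n \<le> \<gamma> (n + 1) * \<theta> (n + 1) n" using up elim(2) by force
      then show ?case using elim(1) by (simp add: s_def gamma_Suc[simplified] algebra_simps)
    qed
    then show False using no_bounded_drift[OF c(1) _ s0] by blast
  qed
  show "\<exists>n\<ge>1. \<gamma> n * \<theta> n n < \<gamma> (n + 1) * \<theta> (n + 1) n" if "B > 0"
  proof (rule ccontr)
    assume down: "\<not> ?thesis"
    have "\<forall>\<^sub>F n in sequentially. s n + c \<le> s (n + 1)"
      using c(3)[rule_format, OF that, THEN eventually_sequentially_Suc[of "\<lambda>n. \<gamma> n * \<theta> n n - \<gamma> n * \<theta> n (n - 1) \<le> pi - c", THEN iffD2]]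
        eventually_ge_at_top[of 1]
    proof eventually_elim
      case (elim n)
      have "\<gamma> (n + 1) * \<theta> (n + 1) n \<le> \<gamma> n * \<theta> n n" using down elim(2) by force
      then show ?case using elim(1) by (simp add: s_def gamma_Suc[simplified] algebra_simps)
    qed
    then show False using no_bounded_drift[OF c(1) _ sK] by blast
  qed
qed

end

lemma D_up_iff:
  assumes "\<alpha> > -1" "\<beta> > -1"
  shows "(\<alpha>, \<beta>) \<in> D_up \<longleftrightarrow> 1/4 - \<beta>\<^sup>2 \<ge> 0 \<and> (1/4 - \<alpha>\<^sup>2) + 3 * (1/4 - \<beta>\<^sup>2) \<ge> 0"
proof -
  have "\<bar>\<beta>\<bar> \<le> 1/2 \<longleftrightarrow> \<beta>\<^sup>2 \<le> 1/4" using abs_le_square_iff[of \<beta> "1/2"] by (simp add: power2_eq_square)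
  then show ?thesis using assms by (auto simp: D_up_def)
qed

lemma D_down_iff:
  assumes "\<alpha> > -1" "\<beta> > -1"
  shows "(\<alpha>, \<beta>) \<in> D_down \<longleftrightarrow> 1/4 - \<beta>\<^sup>2 \<le> 0 \<and> (1/4 - \<alpha>\<^sup>2) + 3 * (1/4 - \<beta>\<^sup>2) \<le> 0"
proof -
  have "\<bar>\<beta>\<bar> \<ge> 1/2 \<longleftrightarrow> \<beta>\<^sup>2 \<ge> 1/4" using abs_le_square_iff[of "1/2" \<beta>] by (simp add: power2_eq_square)
  then show ?thesis using assms by (auto simp: D_down_def)
qed

theorem corollary2p5:
  fixes \<alpha> \<beta> :: real
  assumes "\<alpha> > -1" and "\<beta> > -1"
  shows "((\<forall>n\<ge>1. \<forall>k\<in>{1..n}.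
            jacobi_gamma \<alpha> \<beta> n * jacobi_theta \<alpha> \<beta> n k
              \<le> jacobi_gamma \<alpha> \<beta> (n + 1) * jacobi_theta \<alpha> \<beta> (n + 1) k)
          \<longleftrightarrow> (\<alpha>, \<beta>) \<in> D_up)
       \<and> ((\<forall>n\<ge>1. \<forall>k\<in>{1..n}.
            jacobi_gamma \<alpha> \<beta> (n + 1) * jacobi_theta \<alpha> \<beta> (n + 1) k
              \<le> jacobi_gamma \<alpha> \<beta> n * jacobi_theta \<alpha> \<beta> n k)
          \<longleftrightarrow> (\<alpha>, \<beta>) \<in> D_down)"
    (is "(?up \<longleftrightarrow> _) \<and> (?down \<longleftrightarrow> _)")
proof (intro conjI iffI)
  show "(\<alpha>, \<beta>) \<in> D_up" if up: ?up
    unfolding D_up_iff[OF assms]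
  proof (intro conjI)
    show "1/4 - \<beta>\<^sup>2 \<ge> 0"
    proof (rule ccontr)
      assume "\<not> ?thesis"
      then obtain n where "n \<ge> 1" "jacobi_gamma \<alpha> \<beta> (n + 1) * jacobi_theta \<alpha> \<beta> (n + 1) n < jacobi_gamma \<alpha> \<beta> n * jacobi_theta \<alpha> \<beta> n n"
        using last_theta_comparison(1)[OF assms] by force
      moreover from this have "n \<in> {1..n}" by simp
      ultimately show False using up by (meson linorder_not_le)
    qed
    show "(1/4 - \<alpha>\<^sup>2) + 3 * (1/4 - \<beta>\<^sup>2) \<ge> 0"
    proof (rule ccontr)
      assume "\<not> ?thesis"
      then obtain n where "n \<ge> 1" "jacobi_gamma \<alpha> \<beta> (n + 1) * jacobi_theta \<alpha> \<beta> (n + 1) 1 < jacobi_gamma \<alpha> \<beta> n * jacobi_theta \<alpha> \<beta> n 1"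
        using first_theta_comparison[OF assms] by (metis linorder_not_le order_less_irrefl)
      moreover from this have "1 \<in> {1..n}" by simp
      ultimately show False using up by (meson linorder_not_le)
    qed
  qed
  show ?up if "(\<alpha>, \<beta>) \<in> D_up"
    using that scaled_theta_increasing[OF assms] unfolding D_up_iff[OF assms] by blast
  show "(\<alpha>, \<beta>) \<in> D_down" if down: ?down
    unfolding D_down_iff[OF assms]
  proof (intro conjI)
    show "1/4 - \<beta>\<^sup>2 \<le> 0"
    proof (rule ccontr)
      assume "\<not> ?thesis"
      then obtain n where "n \<ge> 1" "jacobi_gamma \<alpha> \<beta> n * jacobi_theta \<alpha> \<beta> n n < jacobi_gamma \<alpha> \<beta> (n + 1) * jacobi_theta \<alpha> \<beta> (n + 1) n"
        using last_theta_comparison(2)[OF assms] by force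
      moreover from this have "n \<in> {1..n}" by simp
      ultimately show False using down by (meson linorder_not_le)
    qed
    show "(1/4 - \<alpha>\<^sup>2) + 3 * (1/4 - \<beta>\<^sup>2) \<le> 0"
    proof (rule ccontr)
      assume "\<not> ?thesis"
      then obtain n where "n \<ge> 1" "jacobi_gamma \<alpha> \<beta> n * jacobi_theta \<alpha> \<beta> n 1 < jacobi_gamma \<alpha> \<beta> (n + 1) * jacobi_theta \<alpha> \<beta> (n + 1) 1"
        using first_theta_comparison[OF assms] by (metis linorder_not_le order_less_irrefl)
      moreover from this have "1 \<in> {1..n}" by simp
      ultimately show False using down by (meson linorder_not_le)
    qed
  qed
  show ?down if "(\<alpha>, \<beta>) \<in> D_down"
    using that scaled_theta_decreasing[OF assms] unfolding D_down_iff[OF assms] by blast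
qed

end
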